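(* Let $[A]\in\hat V$ be a normal template. Define $$\mathfrak{I}_A=\{[B]\in\mathcal{O}^l_A\mid B_{ts}=0\text{ for all }(t,s)\in\hat{\mathcal H}^{\mathfrak a}\}.$$ Then $\{\mathcal{O}^r_B\mid[B]\in\mathfrak{I}_A\}$ is the complete set of pairwise disjoint right orbits in $\mathcal{O}^{bi}_A$; that is, every right orbit contained in $\mathcal{O}^{bi}_A$ is of the form $\mathcal{O}^r_B$ with $[B]\in\mathfrak{I}_A$, and $\mathcal{O}^r_B\cap\mathcal{O}^r_C=\emptyset$ for distinct $[B],[C]\in\mathfrak{I}_A$.
   Context: Let $n\ge1$, $q$ a prime power, $\Phi^+=\{(i,j)\mid 1\le i<j\le n\}$, and let $J\subseteq\Phi^+$ be row closed: $(i,j)\in J$ implies $(i,l)\in J$ for all $i<l\le n$. Let $E$ be the identity of $M_n(q)=M_n(\mathbb{F}_q)$, $V=\{A\in M_n(q)\mid A_{ij}\neq0\Rightarrow(i,j)\in J\}$, $U=\{u\in M_n(q)\mid u-E\in V\}$ (a group), and $\pi_J:M_n(q)\to V$ the projection setting entries outside $J$ to zero. Fix a nontrivial character $\theta:(\mathbb{F}_q,+)\to\mathbb{C}^*$. For $A\in V$ let $[A]:V\to\mathbb{C}^*$, $[A](B)=\theta\big(\sum_{(i,j)\in J}A_{ij}B_{ij}\big)$; $A\mapsto[A]$ is a bijection from $V$ onto the set $\hat V$ of linear characters of $(V,+)$; entries, rows, columns of $[A]$ mean those of $A$. $U$ acts on $\hat V$ from both sides by $u.[A].v=[\pi_J((u^{-1})^tA(v^{-1})^t)]$.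 Put $\mathcal{O}^l_A=U.[A]$, $\mathcal{O}^r_A=[A].U$, $\mathcal{O}^{bi}_A=U.[A].U$. Column $j$ and all positions in it are normal if row $j$ is not contained in $J$, i.e. $(j,l)\notin J$ for all $l>j$ (so column $n$ is normal). The hook at $(i,j)\in J$ has center $(i,j)$, arm $\{(i,k)\in J\mid i<k<j\}$ and leg $\{(k,j)\in J\mid i<k<j\}$. $[A]$ is a template if for every nonzero row $i$ with rightmost nonzero entry at $(i,j)$ one has $A_{kj}=0$ for all $i<k<j$; the positions $(i,j)$ are the main conditions, forming $\mathfrak{p}=\mathfrak{p}[A]$ (they lie in distinct rows and columns). Main hook intersections are the positions $(a,f)$ with $(a,b),(e,f)\in\mathfrak{p}$, $e<a<f<b$. A template is normal if it vanishes at all nonnormal positions on arms of hooks centered at main conditions which are not main hook intersections. Let $[A]$ be a normal template. For each $(a,b)\in\mathfrak{p}$ let $\mathcal{R}_a=\{e\mid \exists f:(e,f)\in\mathfrak{p},\ e<a<f<b\}$; $\hat{\mathcal C}_a=\{s\mid a<s<b,\ A_{es}\ne0\text{ for some }e\in\mathcal{R}_a\}$; $\mathcal{C}_a=\{s\in\hat{\mathcal C}_a\mid \text{column }s\text{ normal}\}$; $\mathcal{C}^{\mathfrak n}_a=\{s\in\mathcal{C}_a\mid (t,s)\in\mathfrak{p}\text{ for some }t<a\}$; $\hat\Gamma_a$ and $\Gamma_a$ the submatrices of $A$ with rows $\mathcal{R}_a$ and columns $\hat{\mathcal C}_a$, respectively $\mathcal{C}_a$. The columns of $\Gamma_a$ indexed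 by $\mathcal{C}^{\mathfrak n}_a$ are linearly independent. Choose $\mathcal{C}^{\mathfrak i}_a\subseteq\mathcal{C}_a\setminus\mathcal{C}^{\mathfrak n}_a$ such that the columns indexed by $\mathcal{C}^{\mathfrak n}_a\cup\mathcal{C}^{\mathfrak i}_a$ form a basis of the column space of $\Gamma_a$, and then $\hat{\mathcal C}^{\mathfrak a}_a\subseteq\hat{\mathcal C}_a\setminus\mathcal{C}_a$ such that the columns indexed by $\mathcal{C}^{\mathfrak n}_a\cup\mathcal{C}^{\mathfrak i}_a\cup\hat{\mathcal C}^{\mathfrak a}_a$ form a basis of the column space of $\hat\Gamma_a$. These choices are fixed, and $\hat{\mathcal H}^{\mathfrak a}$ is the set of all $(a,s)$ with $(a,b)\in\mathfrak{p}$ for some $b$ and $s\in\hat{\mathcal C}^{\mathfrak a}_a$. *)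

theory Defs
  imports "HOL-Analysis.Analysis"
begin

text \<open>
  Matrices over the finite field \<open>'a\<close> with \<open>q = CARD('a)\<close> elements are indexed by a finite
  linearly ordered type \<open>'n\<close>, which plays the role of \<open>{1, \<dots>, n}\<close> with \<open>n = CARD('n)\<close>.
  Only the order of the indices matters.
\<close>

type_synonym ('a, 'n) sqmat = "'a ^ 'n ^ 'n"

section \<open>The group, the vector space and its linear characters\<close>

definition pos_roots :: "('n::linorder \<times> 'n) set" where
  "pos_roots = {(i, j). i < j}"

text \<open>The condition is on all \<open>l > i\<close>, not only on \<open>l > j\<close>: a row of \<open>J\<close> is either empty or full.\<close>

definition row_closed :: "('n::linorder \<times> 'n) set \<Rightarrow> bool" where
  "row_closed J \<longleftrightarrow> (\<forall>i j l. (i, j) \<in> J \<longrightarrow> i < l \<longrightarrow> (i, l) \<in> J)"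

definition pattern_space :: "('n \<times> 'n) set \<Rightarrow> ('a::zero, 'n::finite) sqmat set" where
  "pattern_space J = {A. \<forall>i j. A $ i $ j \<noteq> 0 \<longrightarrow> (i, j) \<in> J}"

definition pattern_group :: "('n \<times> 'n) set \<Rightarrow> ('a::ring_1, 'n::finite) sqmat set" where
  "pattern_group J = {u. u - mat 1 \<in> pattern_space J}"

definition pattern_proj :: "('n \<times> 'n) set \<Rightarrow> ('a::zero, 'n::finite) sqmat \<Rightarrow> ('a, 'n) sqmat" where
  "pattern_proj J M = (\<chi> i j. if (i, j) \<in> J then M $ i $ j else 0)"

definition nontrivial_add_char :: "('a::monoid_add \<Rightarrow> complex) \<Rightarrow> bool" where
  "nontrivial_add_char \<theta> \<longleftrightarrow>
     (\<forall>x. \<theta> x \<noteq> 0) \<and> (\<forall>x y. \<theta> (x + y) = \<theta> x * \<theta> y) \<and> (\<exists>x. \<theta> x \<noteq> 1)"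

text \<open>Linear characters of \<open>(V, +)\<close>, \<open>V = pattern_space J\<close>, are represented as functions that are
  \<open>undefined\<close> outside of \<open>V\<close>, so that two characters are equal iff they agree on \<open>V\<close>.\<close>

definition linear_chars :: "('n \<times> 'n) set \<Rightarrow> (('a::monoid_add, 'n::finite) sqmat \<Rightarrow> complex) set" where
  "linear_chars J = {\<psi> \<in> extensional (pattern_space J).
     (\<forall>B\<in>pattern_space J. \<psi> B \<noteq> 0) \<and>
     (\<forall>B\<in>pattern_space J. \<forall>C\<in>pattern_space J. \<psi> (B + C) = \<psi> B * \<psi> C)}"

definition mat_char ::
  "('a::comm_ring_1 \<Rightarrow> complex) \<Rightarrow> ('n \<times> 'n) set \<Rightarrow> ('a, 'n::finite) sqmat \<Rightarrow> ('a, 'n) sqmat \<Rightarrow> complex" where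
  "mat_char \<theta> J A = (\<lambda>B\<in>pattern_space J. \<theta> (\<Sum>(i, j)\<in>J. A $ i $ j * B $ i $ j))"

text \<open>The inverse of the bijection \<open>A \<mapsto> [A]\<close>; see \<open>bij_betw_mat_char\<close> below.\<close>

definition char_mat ::
  "('a::comm_ring_1 \<Rightarrow> complex) \<Rightarrow> ('n \<times> 'n) set \<Rightarrow> (('a, 'n::finite) sqmat \<Rightarrow> complex) \<Rightarrow> ('a, 'n) sqmat" where
  "char_mat \<theta> J = the_inv_into (pattern_space J) (mat_char \<theta> J)"

lemma nontrivial_add_char_sum:
  assumes "nontrivial_add_char (\<theta> :: 'a::field \<Rightarrow> complex)"
  shows "\<theta> (\<Sum>x\<in>S. f x) = (\<Prod>x\<in>S. \<theta> (f x))"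
proof -
  have m: "\<theta> (x + y) = \<theta> x * \<theta> y" and nz: "\<theta> x \<noteq> 0" for x y
    using assms by (auto simp: nontrivial_add_char_def)
  have z: "\<theta> 0 = 1" using m[of 0 0] nz[of 0] by simp
  show ?thesis by (induction S rule: infinite_finite_induct) (auto simp: z m)
qed

lemma sum_add_char_eq_0:
  fixes \<eta> :: "'a::{field, finite} \<Rightarrow> complex"
  assumes m: "\<And>x y. \<eta> (x + y) = \<eta> x * \<eta> y" and "\<eta> a \<noteq> 1"
  shows "(\<Sum>x\<in>UNIV. \<eta> x) = 0"
proof -
  have "(\<Sum>x\<in>UNIV. \<eta> x) = (\<Sum>x\<in>UNIV. \<eta> (a + x))"
    by (rule sum.reindex_bij_witness[of _ "\<lambda>x. a + x" "\<lambda>x. x - a"]) auto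
  also have "\<dots> = \<eta> a * (\<Sum>x\<in>UNIV. \<eta> x)" by (simp add: m sum_distrib_left)
  finally show ?thesis using assms(2) by simp
qed

lemma add_char_eq_scaled:
  fixes \<eta> \<theta> :: "'a::{field, finite} \<Rightarrow> complex"
  assumes \<theta>: "nontrivial_add_char \<theta>"
    and nz: "\<And>x. \<eta> x \<noteq> 0" and m: "\<And>x y. \<eta> (x + y) = \<eta> x * \<eta> y"
  shows "\<exists>c. \<forall>x. \<eta> x = \<theta> (c * x)"
proof (rule ccontr)
  assume neg: "\<nexists>c. \<forall>x. \<eta> x = \<theta> (c * x)"
  have t: "\<theta> (x + y) = \<theta> x * \<theta> y" "\<theta> x \<noteq> 0" for x y
    using \<theta> by (auto simp: nontrivial_add_char_def)
  have td: "\<theta> (x - y) = \<theta> x * \<theta> (- y)" for x y using t(1)[of x "- y"] by simp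
  obtain a where a: "\<theta> a \<noteq> 1" using \<theta> by (auto simp: nontrivial_add_char_def)
  have z: "\<theta> 0 = 1" "\<eta> 0 = 1" using t(1)[of 0 0] t(2)[of 0] m[of 0 0] nz[of 0] by simp_all
  have inner: "(\<Sum>x\<in>UNIV. \<eta> x * \<theta> (- (c * x))) = 0" for c
  proof -
    obtain x where x: "\<eta> x \<noteq> \<theta> (c * x)" using neg by blast
    have "\<theta> (c * x) * \<theta> (- (c * x)) = 1" using t(1)[of "c * x" "- (c * x)"] z by simp
    hence "\<eta> x * \<theta> (- (c * x)) \<noteq> 1" using x t(2) by (metis mult_right_cancel)
    thus ?thesis
      by (intro sum_add_char_eq_0[where a = x]) (auto simp: m td distrib_left)
  qed
  have outer: "(\<Sum>c\<in>UNIV. \<eta> x * \<theta> (- (c * x))) = (if x = 0 then of_nat CARD('a) else 0)" for x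
  proof (cases "x = 0")
    case False
    have "(\<Sum>c\<in>UNIV. \<theta> (- (c * x))) = 0"
      by (rule sum_add_char_eq_0[where a = "- a / x"]) (use a False in \<open>auto simp: t(1) td ring_distribs\<close>)
    thus ?thesis using False by (simp add: sum_distrib_left[symmetric])
  qed (simp add: z)
  have "0 = (\<Sum>c\<in>UNIV. \<Sum>x\<in>UNIV. \<eta> x * \<theta> (- (c * x)))" by (simp add: inner)
  also have "\<dots> = (\<Sum>x\<in>UNIV. \<Sum>c\<in>UNIV. \<eta> x * \<theta> (- (c * x)))" by (rule sum.swap)
  also have "\<dots> = of_nat CARD('a)" by (simp add: outer)
  finally show False by simp
qed

lemma bij_betw_mat_char:
  fixes \<theta> :: "'a::{field, finite} \<Rightarrow> complex" and J :: "('n::finite \<times> 'n) set"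
  assumes \<theta>: "nontrivial_add_char \<theta>"
  shows "bij_betw (mat_char \<theta> J) (pattern_space J) (linear_chars J)"
proof -
  define unit :: "'n \<times> 'n \<Rightarrow> 'a \<Rightarrow> ('a, 'n) sqmat"
    where "unit p x = (\<chi> i j. if (i, j) = p then x else 0)" for p x
  have t: "\<theta> (x + y) = \<theta> x * \<theta> y" "\<theta> x \<noteq> 0" for x y
    using \<theta> by (auto simp: nontrivial_add_char_def)
  obtain a where a: "\<theta> a \<noteq> 1" using \<theta> by (auto simp: nontrivial_add_char_def)
  have unit_V: "unit p x \<in> pattern_space J" if "p \<in> J" for p x
    using that by (auto simp: unit_def pattern_space_def split: if_splits)
  have char_unit: "mat_char \<theta> J A (unit (i, j) x) = \<theta> (A $ i $ j * x)" if "(i, j) \<in> J" for A i j x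
  proof -
    have "(\<Sum>(k, l)\<in>J. A $ k $ l * unit (i, j) x $ k $ l)
        = (\<Sum>p\<in>J. if p = (i, j) then A $ i $ j * x else 0)"
      by (intro sum.cong) (auto simp: unit_def split: if_splits)
    also have "\<dots> = A $ i $ j * x" using that by simp
    finally show ?thesis using unit_V[OF that] by (simp add: mat_char_def)
  qed
  have inj: "inj_on (mat_char \<theta> J) (pattern_space J)"
  proof (rule inj_onI)
    fix A B assume A: "A \<in> pattern_space J" and B: "B \<in> pattern_space J"
      and eq: "mat_char \<theta> J A = mat_char \<theta> J B"
    have "A $ i $ j = B $ i $ j" for i j
    proof (cases "(i, j) \<in> J")
      case True
      show ?thesis
      proof (rule ccontr)
        assume ne: "A $ i $ j \<noteq> B $ i $ j"
        define x where "x = a / (A $ i $ j - B $ i $ j)"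
        have "\<theta> (A $ i $ j * x) = \<theta> (B $ i $ j * x)" using char_unit[OF True] eq by metis
        moreover have "A $ i $ j * x = B $ i $ j * x + a"
          using ne by (simp add: x_def field_simps)
        ultimately show False using a t by simp
      qed
    next
      case False
      thus ?thesis using A B by (metis (mono_tags, lifting) mem_Collect_eq pattern_space_def)
    qed
    thus "A = B" by (simp add: vec_eq_iff)
  qed
  have "mat_char \<theta> J A \<in> linear_chars J" for A
    by (auto simp: mat_char_def linear_chars_def pattern_space_def t distrib_left sum.distrib
        case_prod_unfold) (metis add.right_neutral)+
  moreover have "\<psi> \<in> mat_char \<theta> J ` pattern_space J" if \<psi>: "\<psi> \<in> linear_chars J" for \<psi>
  proof -
    have V_add: "B + C \<in> pattern_space J"
      if "B \<in> pattern_space J" "C \<in> pattern_space J" for B C :: "('a, 'n) sqmat"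
      using that by (simp add: pattern_space_def) (metis add.right_neutral)
    have V0: "0 \<in> pattern_space J" by (simp add: pattern_space_def)
    have pm: "\<psi> (B + C) = \<psi> B * \<psi> C" if "B \<in> pattern_space J" "C \<in> pattern_space J" for B C
      using \<psi> that by (simp add: linear_chars_def)
    have pnz: "\<psi> B \<noteq> 0" if "B \<in> pattern_space J" for B
      using \<psi> that by (simp add: linear_chars_def)
    have p0: "\<psi> 0 = 1" using pm[OF V0 V0] pnz[OF V0] by simp
    have "\<exists>c. \<forall>x. \<psi> (unit p x) = \<theta> (c * x)" if "p \<in> J" for p
    proof (rule add_char_eq_scaled[OF \<theta>])
      show "\<psi> (unit p x) \<noteq> 0" for x using pnz unit_V that by blast
      have "unit p (x + y) = unit p x + unit p y" for x y
        by (simp add: unit_def vec_eq_iff)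
      thus "\<psi> (unit p (x + y)) = \<psi> (unit p x) * \<psi> (unit p y)" for x y
        using pm unit_V that by simp
    qed
    then obtain c where c: "\<And>p x. p \<in> J \<Longrightarrow> \<psi> (unit p x) = \<theta> (c p * x)" by metis
    define A :: "('a, 'n) sqmat" where "A = (\<chi> i j. if (i, j) \<in> J then c (i, j) else 0)"
    have A: "A \<in> pattern_space J" by (simp add: A_def pattern_space_def)
    have sum_V: "(\<Sum>p\<in>S. unit p (f p)) \<in> pattern_space J \<and>
        \<psi> (\<Sum>p\<in>S. unit p (f p)) = (\<Prod>p\<in>S. \<psi> (unit p (f p)))" if "S \<subseteq> J" for S f
    proof -
      have "finite S" by simp
      thus ?thesis using that
        by (induction S) (auto simp: V0 p0 V_add unit_V pm)
    qed
    have "\<psi> B = mat_char \<theta> J A B" if B: "B \<in> pattern_space J" for B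
    proof -
      have "B = (\<Sum>p\<in>J. unit p (B $ fst p $ snd p))"
      proof -
        have "(\<Sum>p\<in>J. unit p (B $ fst p $ snd p)) $ i $ j = B $ i $ j" for i j
        proof -
          have "(\<Sum>p\<in>J. unit p (B $ fst p $ snd p)) $ i $ j
              = (\<Sum>p\<in>J. if p = (i, j) then B $ i $ j else 0)"
            unfolding sum_component by (intro sum.cong) (auto simp: unit_def)
          also have "\<dots> = B $ i $ j" using B by (auto simp: pattern_space_def)
          finally show ?thesis .
        qed
        thus ?thesis by (simp add: vec_eq_iff)
      qed
      hence "\<psi> B = (\<Prod>p\<in>J. \<psi> (unit p (B $ fst p $ snd p)))"
        using sum_V[of J "\<lambda>p. B $ fst p $ snd p"] by simp
      also have "\<dots> = (\<Prod>p\<in>J. \<theta> (A $ fst p $ snd p * B $ fst p $ snd p))"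
        by (intro prod.cong) (auto simp: c A_def)
      also have "\<dots> = mat_char \<theta> J A B"
        using B by (simp add: mat_char_def nontrivial_add_char_sum[OF \<theta>] case_prod_unfold)
      finally show ?thesis .
    qed
    moreover have "\<psi> B = mat_char \<theta> J A B" if "B \<notin> pattern_space J" for B
      using \<psi> that by (simp add: mat_char_def linear_chars_def extensional_def)
    ultimately have "\<psi> = mat_char \<theta> J A" by blast
    thus ?thesis using A by blast
  qed
  ultimately show ?thesis using inj by (auto simp: bij_betw_def)
qed

section \<open>The action on characters and its orbits\<close>

definition char_act ::
  "('a::field \<Rightarrow> complex) \<Rightarrow> ('n::finite \<times> 'n) set \<Rightarrow>
   ('a, 'n) sqmat \<Rightarrow> (('a, 'n) sqmat \<Rightarrow> complex) \<Rightarrow> ('a, 'n) sqmat \<Rightarrow> (('a, 'n) sqmat \<Rightarrow> complex)" where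
  "char_act \<theta> J u \<psi> v = mat_char \<theta> J (pattern_proj J
     (transpose (matrix_inv u) ** char_mat \<theta> J \<psi> ** transpose (matrix_inv v)))"

definition left_orbit ::
  "('a::field \<Rightarrow> complex) \<Rightarrow> ('n::finite \<times> 'n) set \<Rightarrow>
   (('a, 'n) sqmat \<Rightarrow> complex) \<Rightarrow> (('a, 'n) sqmat \<Rightarrow> complex) set" where
  "left_orbit \<theta> J \<psi> = {char_act \<theta> J u \<psi> (mat 1) | u. u \<in> pattern_group J}"

definition right_orbit ::
  "('a::field \<Rightarrow> complex) \<Rightarrow> ('n::finite \<times> 'n) set \<Rightarrow>
   (('a, 'n) sqmat \<Rightarrow> complex) \<Rightarrow> (('a, 'n) sqmat \<Rightarrow> complex) set" where
  "right_orbit \<theta> J \<psi> = {char_act \<theta> J (mat 1) \<psi> v | v. v \<in> pattern_group J}"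

definition bi_orbit ::
  "('a::field \<Rightarrow> complex) \<Rightarrow> ('n::finite \<times> 'n) set \<Rightarrow>
   (('a, 'n) sqmat \<Rightarrow> complex) \<Rightarrow> (('a, 'n) sqmat \<Rightarrow> complex) set" where
  "bi_orbit \<theta> J \<psi> = {char_act \<theta> J u \<psi> v | u v. u \<in> pattern_group J \<and> v \<in> pattern_group J}"

section \<open>Normal templates\<close>

definition normal_column :: "('n::linorder \<times> 'n) set \<Rightarrow> 'n \<Rightarrow> bool" where
  "normal_column J j \<longleftrightarrow> (\<forall>l. j < l \<longrightarrow> (j, l) \<notin> J)"

definition hook_arm :: "('n::linorder \<times> 'n) set \<Rightarrow> 'n \<Rightarrow> 'n \<Rightarrow> ('n \<times> 'n) set" where
  "hook_arm J i j = {(i, k) | k. (i, k) \<in> J \<and> i < k \<and> k < j}"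

text \<open>The positions of the rightmost nonzero entries of the nonzero rows.\<close>

definition main_conditions :: "('a::zero, 'n::{finite, linorder}) sqmat \<Rightarrow> ('n \<times> 'n) set" where
  "main_conditions A = {(i, j). A $ i $ j \<noteq> 0 \<and> (\<forall>l. j < l \<longrightarrow> A $ i $ l = 0)}"

definition is_template :: "('a::zero, 'n::{finite, linorder}) sqmat \<Rightarrow> bool" where
  "is_template A \<longleftrightarrow>
     (\<forall>(i, j)\<in>main_conditions A. \<forall>k. i < k \<and> k < j \<longrightarrow> A $ k $ j = 0)"

definition main_hook_intersections ::
  "('a::zero, 'n::{finite, linorder}) sqmat \<Rightarrow> ('n \<times> 'n) set" where
  "main_hook_intersections A = {(a, f) | a b e f.
     (a, b) \<in> main_conditions A \<and> (e, f) \<in> main_conditions A \<and> e < a \<and> a < f \<and> f < b}"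

definition is_normal_template ::
  "('n \<times> 'n) set \<Rightarrow> ('a::zero, 'n::{finite, linorder}) sqmat \<Rightarrow> bool" where
  "is_normal_template J A \<longleftrightarrow> is_template A \<and>
     (\<forall>(i, j)\<in>main_conditions A. \<forall>(r, k)\<in>hook_arm J i j.
        \<not> normal_column J k \<longrightarrow> (r, k) \<notin> main_hook_intersections A \<longrightarrow> A $ r $ k = 0)"

section \<open>The index sets attached to a main condition\<close>

text \<open>In the following definitions, \<open>b\<close> with \<open>(a, b)\<close> a main condition is unique if it exists,
  so the sets depend on \<open>a\<close> only; they are empty if row \<open>a\<close> of \<open>A\<close> is zero.\<close>

definition rows_of :: "('a::zero, 'n::{finite, linorder}) sqmat \<Rightarrow> 'n \<Rightarrow> 'n set" where
  "rows_of A a = {e. \<exists>b f. (a, b) \<in> main_conditions A \<and> (e, f) \<in> main_conditions A \<and>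
     e < a \<and> a < f \<and> f < b}"

definition cols_hat :: "('a::zero, 'n::{finite, linorder}) sqmat \<Rightarrow> 'n \<Rightarrow> 'n set" where
  "cols_hat A a = {s. \<exists>b. (a, b) \<in> main_conditions A \<and> a < s \<and> s < b \<and>
     (\<exists>e\<in>rows_of A a. A $ e $ s \<noteq> 0)}"

definition cols_normal ::
  "('n \<times> 'n) set \<Rightarrow> ('a::zero, 'n::{finite, linorder}) sqmat \<Rightarrow> 'n \<Rightarrow> 'n set" where
  "cols_normal J A a = {s \<in> cols_hat A a. normal_column J s}"

definition cols_main ::
  "('n \<times> 'n) set \<Rightarrow> ('a::zero, 'n::{finite, linorder}) sqmat \<Rightarrow> 'n \<Rightarrow> 'n set" where
  "cols_main J A a = {s \<in> cols_normal J A a. \<exists>t<a. (t, s) \<in> main_conditions A}"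

text \<open>The submatrix with rows \<open>R\<close> and columns \<open>C\<close>, padded with zeros to the full format. This
  does not affect linear (in)dependence of its columns.\<close>

definition submat :: "('a::zero, 'n::finite) sqmat \<Rightarrow> 'n set \<Rightarrow> 'n set \<Rightarrow> ('a, 'n) sqmat" where
  "submat A R C = (\<chi> i j. if i \<in> R \<and> j \<in> C then A $ i $ j else 0)"

definition Gamma_hat :: "('a::zero, 'n::{finite, linorder}) sqmat \<Rightarrow> 'n \<Rightarrow> ('a, 'n) sqmat" where
  "Gamma_hat A a = submat A (rows_of A a) (cols_hat A a)"

definition Gamma ::
  "('n \<times> 'n) set \<Rightarrow> ('a::zero, 'n::{finite, linorder}) sqmat \<Rightarrow> 'n \<Rightarrow> ('a, 'n) sqmat" where
  "Gamma J A a = submat A (rows_of A a) (cols_normal J A a)"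

text \<open>The family of columns of \<open>M\<close> indexed by \<open>S\<close> is a basis of the column space of \<open>M\<close>;
  injectivity is needed because linear independence is that of a family, not just of a set.\<close>

definition column_basis :: "('a::field, 'n::finite) sqmat \<Rightarrow> 'n set \<Rightarrow> bool" where
  "column_basis M S \<longleftrightarrow> inj_on (\<lambda>s. column s M) S \<and>
     vec.independent ((\<lambda>s. column s M) ` S) \<and>
     vec.span ((\<lambda>s. column s M) ` S) = vec.span (columns M)"

text \<open>\<open>Ci\<close> and \<open>Ca\<close> are families of choices, the latter of additional nonnormal columns.\<close>

definition column_choice ::
  "('n \<times> 'n) set \<Rightarrow> ('a::field, 'n::{finite, linorder}) sqmat \<Rightarrow>
   ('n \<Rightarrow> 'n set) \<Rightarrow> ('n \<Rightarrow> 'n set) \<Rightarrow> bool" where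
  "column_choice J A Ci Ca \<longleftrightarrow> (\<forall>(a, b)\<in>main_conditions A.
     Ci a \<subseteq> cols_normal J A a - cols_main J A a \<and>
     column_basis (Gamma J A a) (cols_main J A a \<union> Ci a) \<and>
     Ca a \<subseteq> cols_hat A a - cols_normal J A a \<and>
     column_basis (Gamma_hat A a) (cols_main J A a \<union> Ci a \<union> Ca a))"

definition H_hat ::
  "('a::zero, 'n::{finite, linorder}) sqmat \<Rightarrow> ('n \<Rightarrow> 'n set) \<Rightarrow> ('n \<times> 'n) set" where
  "H_hat A Ca = {(a, s). (\<exists>b. (a, b) \<in> main_conditions A) \<and> s \<in> Ca a}"

definition I_set ::
  "('a::field \<Rightarrow> complex) \<Rightarrow> ('n \<times> 'n) set \<Rightarrow> ('a, 'n::{finite, linorder}) sqmat \<Rightarrow>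
   ('n \<Rightarrow> 'n set) \<Rightarrow> (('a, 'n) sqmat \<Rightarrow> complex) set" where
  "I_set \<theta> J A Ca = {mat_char \<theta> J B | B. B \<in> pattern_space J \<and>
     mat_char \<theta> J B \<in> left_orbit \<theta> J (mat_char \<theta> J A) \<and>
     (\<forall>(t, s)\<in>H_hat A Ca. B $ t $ s = 0)}"

end

theory Submission
  imports Defs
begin

text \<open>
  The left and the right action commute. Hence the right orbits in the biorbit of \<open>A\<close>
  are those of the matrices \<open>g.A\<close>, and the elements of the left orbit lying in the
  right orbit of \<open>g.A\<close> are precisely \<open>g.(L \<inter> R)\<close>, where
  \<open>L\<close> and \<open>R\<close> are the left and the right orbit of \<open>A\<close>
  itself. So the claim is that each translate \<open>g.(L \<inter> R)\<close> contains exactly one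
  matrix vanishing on \<open>H_hat\<close> (\<open>unique_representative\<close>).

  Since the acting group is \<open>1 + V\<close> for a linear space \<open>V\<close>, both orbits
  are affine: \<open>L = A + W\<^sub>l\<close> and \<open>R = A + W\<^sub>r\<close> for linear
  spaces of directions (\<open>orbits_inter\<close>). In a template, a main condition is the last
  nonzero entry of its column. The main conditions to the right of a nonnormal column
  \<open>s\<close> therefore form a triangular system: adding multiples of their columns to column
  \<open>s\<close> changes the entries of column \<open>s\<close> in their rows arbitrarily and
  independently of each other. All other rows with index less than \<open>s\<close> are zero to the
  right of column \<open>s\<close>, and the entries below them are truncated. So
  \<open>W\<^sub>r\<close> consists of all matrices supported on the nonnormal positions on arms
  of hooks centered at main conditions (\<open>right_directions_template\<close>). This is a
  coordinate space, and \<open>W\<^sub>l\<close> is a direct sum over rows because left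
  multiplication builds each row separately. Hence the intersection is a direct sum over rows as
  well, and the piece at row \<open>a\<close> consists of the combinations of the rows in
  \<open>rows_of A a\<close>, truncated to the columns beyond \<open>a\<close>, that vanish in all
  normal columns (\<open>directions_inter\<close>).

  The entries of such a combination in a column basis of \<open>Gamma_hat\<close> are arbitrary
  and determine it. Vanishing in the normal columns amounts to vanishing in the normal basis
  columns, so the entries in the remaining basis columns \<open>Ca a\<close> are coordinates on
  the piece at row \<open>a\<close> (\<open>hook_row_space_eq_0\<close>,
  \<open>hook_row_space_interpolate\<close>). Finally, \<open>g\<close> changes row
  \<open>a\<close> only by multiples of earlier rows, so prescribing the entries of
  \<open>g.X\<close> on \<open>H_hat\<close> determines \<open>X\<close> row by row
  (\<open>unique_correction\<close>).
\<close>

section \<open>Pattern groups and triangular systems\<close>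

lemma wf_less_finite_linorder:
  "wf {(x, y :: 'n::{finite, linorder}). x < y}" "wf {(x, y :: 'n::{finite, linorder}). y < x}"
  by (rule wf_finite_segments; auto simp: irrefl_def trans_def)+

lemma trans_row_closed: "J \<subseteq> pos_roots \<Longrightarrow> row_closed J \<Longrightarrow> trans J"
  by (rule transI) (metis case_prodD mem_Collect_eq order.strict_trans pos_roots_def row_closed_def subset_iff)

lemma matrix_add_rdistrib: "(A + B) ** C = A ** C + B ** (C :: 'a::semiring_1 ^ 'n ^ 'm)"
  by (vector matrix_matrix_mult_def sum.distrib[symmetric] distrib_right)

lemma pattern_spaceD: "A \<in> pattern_space J \<Longrightarrow> A $ i $ j \<noteq> 0 \<Longrightarrow> (i, j) \<in> J"
  by (simp add: pattern_space_def)

lemma pattern_groupD: "u \<in> pattern_group J \<Longrightarrow> u $ i $ j \<noteq> 0 \<Longrightarrow> i = j \<or> (i, j) \<in> J"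
  by (auto simp: pattern_group_def pattern_space_def mat_def dest: spec2[of _ i j])

lemma pattern_groupE:
  assumes "u \<in> pattern_group J"
  obtains N where "u = mat 1 + N" "N \<in> pattern_space J"
  using assms by (auto simp: pattern_group_def intro: that[of "u - mat 1"])

lemma pattern_space_mult:
  assumes "trans J" "M \<in> pattern_space J" "N \<in> pattern_space J"
  shows "M ** (N :: ('a::semiring_1, 'n::finite) sqmat) \<in> pattern_space J"
  unfolding pattern_space_def
proof safe
  fix i j assume "(M ** N) $ i $ j \<noteq> 0"
  then obtain k where "M $ i $ k * N $ k $ j \<noteq> 0"
    by (force simp: matrix_matrix_mult_def intro: sum.neutral)
  hence "M $ i $ k \<noteq> 0" "N $ k $ j \<noteq> 0" by auto
  hence "(i, k) \<in> J" "(k, j) \<in> J" using assms(2,3) by (auto dest: pattern_spaceD)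
  thus "(i, j) \<in> J" using transD[OF assms(1)] by blast
qed

lemma pattern_space_add:
  fixes M N :: "('a::monoid_add, 'n::finite) sqmat"
  assumes "M \<in> pattern_space J" "N \<in> pattern_space J"
  shows "M + N \<in> pattern_space J"
  using assms by (simp add: pattern_space_def) (metis add.right_neutral)

lemma pattern_group_mult:
  fixes u v :: "('a::ring_1, 'n::finite) sqmat"
  assumes J: "trans J" and "u \<in> pattern_group J" "v \<in> pattern_group J"
  shows "u ** v \<in> pattern_group J"
proof -
  from assms obtain M N where uv: "u = mat 1 + M" "v = mat 1 + N" and MN: "M \<in> pattern_space J" "N \<in> pattern_space J"
    by (metis pattern_groupE)
  have "u ** v - mat 1 = M + N + M ** N"
    by (simp add: uv matrix_add_ldistrib matrix_add_rdistrib)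
  moreover have "M + N + M ** N \<in> pattern_space J"
    by (intro pattern_space_add pattern_space_mult J MN)
  ultimately show ?thesis by (simp add: pattern_group_def)
qed

lemma one_in_pattern_group [simp]: "mat 1 \<in> pattern_group J"
  by (simp add: pattern_group_def pattern_space_def)

text \<open>
  Column \<open>j\<close> of \<open>z ** u\<close> is column \<open>j\<close> of \<open>z\<close>
  plus a combination of earlier columns of \<open>z\<close>, so the columns of \<open>z\<close>
  vanish one after the other.
\<close>

lemma unitriangular_right_cancel:
  fixes z :: "('a::ring_1, 'n::{finite, linorder}) sqmat"
  assumes J: "J \<subseteq> pos_roots" and u: "u \<in> pattern_group J" and z: "z ** u = 0"
  shows "z = 0"
proof -
  obtain N where N: "u = mat 1 + N" "N \<in> pattern_space J" using u by (rule pattern_groupE)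
  have eq: "z $ i $ j + (\<Sum>k\<in>UNIV. z $ i $ k * N $ k $ j) = 0" for i j
  proof -
    have "z + z ** N = 0" using z by (simp add: N matrix_add_ldistrib)
    hence "(z + z ** N) $ i $ j = 0" by simp
    thus ?thesis by (simp add: matrix_matrix_mult_def)
  qed
  have "z $ i $ j = 0" for i j
  proof (induction j rule: wf_induct_rule[OF wf_less_finite_linorder(1)])
    case (1 j)
    have "z $ i $ k * N $ k $ j = 0" for k
    proof (cases "N $ k $ j = 0")
      case False
      hence "k < j" using N(2) J by (auto dest!: pattern_spaceD simp: pos_roots_def)
      thus ?thesis using 1 by simp
    qed simp
    hence "(\<Sum>k\<in>UNIV. z $ i $ k * N $ k $ j) = 0" by (intro sum.neutral) simp
    thus ?case using eq[of i j] by simp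
  qed
  thus ?thesis by (simp add: vec_eq_iff)
qed

text \<open>
  Right multiplication by \<open>u\<close> is an injective self-map of the pattern group. Over a
  finite field this set is finite, so the map hits \<open>mat 1\<close>: the inverse of
  \<open>u\<close> lies in the pattern group.
\<close>

lemma pattern_group_inverse:
  fixes u :: "('a::{field, finite}, 'n::{finite, linorder}) sqmat"
  assumes J: "J \<subseteq> pos_roots" "trans J" and u: "u \<in> pattern_group J"
  shows "matrix_inv u \<in> pattern_group J" "u ** matrix_inv u = mat 1" "matrix_inv u ** u = mat 1"
proof -
  have "inj_on (\<lambda>w. w ** u) (pattern_group J)"
  proof (rule inj_onI)
    fix w w' :: "('a, 'n) sqmat" assume "w ** u = w' ** u"
    moreover have "(w - w') ** u + w' ** u = w ** u"
      using matrix_add_rdistrib[of "w - w'" w' u] by simp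
    ultimately have "(w - w') ** u = 0" by simp
    thus "w = w'" using unitriangular_right_cancel[OF J(1) u] by fastforce
  qed
  moreover have "(\<lambda>w. w ** u) ` pattern_group J \<subseteq> pattern_group J"
    using pattern_group_mult[OF J(2)] u by blast
  moreover have "finite (pattern_group J :: ('a, 'n) sqmat set)" by simp
  ultimately have "(\<lambda>w. w ** u) ` pattern_group J = pattern_group J"
    using endo_inj_surj by blast
  then obtain w where w: "w \<in> pattern_group J" "w ** u = mat 1"
    using one_in_pattern_group by (metis (no_types, lifting) imageE)
  have w': "u ** w = mat 1" using w(2) by (simp add: matrix_left_right_inverse)
  have "u ** matrix_inv u = mat 1 \<and> matrix_inv u ** u = mat 1"
    unfolding matrix_inv_def by (rule someI[of _ w]) (use w w' in simp)
  thus *: "u ** matrix_inv u = mat 1" "matrix_inv u ** u = mat 1" by auto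
  have "matrix_inv u = (w ** u) ** matrix_inv u" by (simp add: w)
  also have "\<dots> = w" unfolding matrix_mul_assoc[symmetric] * by simp
  finally show "matrix_inv u \<in> pattern_group J" using w by simp
qed

lemma transpose_pattern_group [simp]:
  "transpose u \<in> pattern_group (J\<inverse>) \<longleftrightarrow> u \<in> pattern_group J"
  by (auto simp: pattern_group_def pattern_space_def transpose_def mat_def)

text \<open>
  The characters are acted on through transposed inverses. These run through the whole lower
  triangular pattern group, which is the pattern group of the converse relation; all later
  arguments use this group and plain matrix products.
\<close>

lemma transpose_inverse_image:
  fixes J :: "('n::{finite, linorder} \<times> 'n) set"
  assumes J: "J \<subseteq> pos_roots" "trans J"
  shows "(\<lambda>u. transpose (matrix_inv u)) ` pattern_group J
    = (pattern_group (J\<inverse>) :: ('a::{field, finite}, 'n) sqmat set)"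
proof safe
  fix u :: "('a, 'n) sqmat" assume "u \<in> pattern_group J"
  thus "transpose (matrix_inv u) \<in> pattern_group (J\<inverse>)" using pattern_group_inverse(1)[OF J] by simp
next
  fix g :: "('a, 'n) sqmat" assume g: "g \<in> pattern_group (J\<inverse>)"
  define w where "w = transpose g"
  have w: "w \<in> pattern_group J" using g transpose_pattern_group[of w J] by (simp add: w_def)
  note 1 = pattern_group_inverse[OF J w]
  note 2 = pattern_group_inverse[OF J 1(1)]
  have "matrix_inv (matrix_inv w) = w ** (matrix_inv w ** matrix_inv (matrix_inv w))"
    unfolding matrix_mul_assoc 1 by simp
  also have "\<dots> = w" unfolding 2 by simp
  finally have "g = transpose (matrix_inv (matrix_inv w))" by (simp add: w_def)
  thus "g \<in> (\<lambda>u. transpose (matrix_inv u)) ` pattern_group J" using 1(1) by blast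
qed

lemma lower_pattern_group_inverse:
  fixes g :: "('a::{field, finite}, 'n::{finite, linorder}) sqmat"
  assumes J: "J \<subseteq> pos_roots" "trans J" and g: "g \<in> pattern_group (J\<inverse>)"
  obtains g' where "g' \<in> pattern_group (J\<inverse>)" "g' ** g = mat 1" "g ** g' = mat 1"
proof -
  have w: "transpose g \<in> pattern_group J" using g transpose_pattern_group[of "transpose g" J] by simp
  note i = pattern_group_inverse[OF J w]
  show ?thesis
  proof (rule that)
    show "transpose (matrix_inv (transpose g)) \<in> pattern_group (J\<inverse>)" using i by simp
    show "transpose (matrix_inv (transpose g)) ** g = mat 1"
      using arg_cong[OF i(2), of transpose] by (simp add: matrix_transpose_mul transpose_mat)
    thus "g ** transpose (matrix_inv (transpose g)) = mat 1" by (simp add: matrix_left_right_inverse)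
  qed
qed

text \<open>
  Back substitution, starting with the largest index.
\<close>

lemma triangular_system_solvable:
  fixes c :: "'n::{finite, linorder} \<Rightarrow> 'n \<Rightarrow> 'a::field"
  assumes diag: "\<And>a. a \<in> E \<Longrightarrow> c a a \<noteq> 0"
    and tri: "\<And>a e. a \<in> E \<Longrightarrow> e \<in> E \<Longrightarrow> e < a \<Longrightarrow> c a e = 0"
  obtains t where "\<And>a. a \<in> E \<Longrightarrow> (\<Sum>e\<in>E. c a e * t e) = y a"
proof -
  have "\<exists>t. \<forall>a. a \<in> E \<longrightarrow> c a a * t a + (\<Sum>e\<in>E \<inter> {a<..}. c a e * t e) = y a"
  proof (rule dependent_wf_choice[OF wf_less_finite_linorder(2),
        where P = "\<lambda>t a r. a \<in> E \<longrightarrow> c a a * r + (\<Sum>e\<in>E \<inter> {a<..}. c a e * t e) = y a"])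
    fix t t' :: "'n \<Rightarrow> 'a" and a r
    assume "\<And>z. (z, a) \<in> {(x, y). y < x} \<Longrightarrow> t z = t' z"
    hence "(\<Sum>e\<in>E \<inter> {a<..}. c a e * t e) = (\<Sum>e\<in>E \<inter> {a<..}. c a e * t' e)"
      by (intro sum.cong) auto
    thus "(a \<in> E \<longrightarrow> c a a * r + (\<Sum>e\<in>E \<inter> {a<..}. c a e * t e) = y a) =
      (a \<in> E \<longrightarrow> c a a * r + (\<Sum>e\<in>E \<inter> {a<..}. c a e * t' e) = y a)" by simp
  next
    fix a and t :: "'n \<Rightarrow> 'a"
    show "\<exists>r. a \<in> E \<longrightarrow> c a a * r + (\<Sum>e\<in>E \<inter> {a<..}. c a e * t e) = y a"
      using diag[of a]
      by (intro exI[of _ "(y a - (\<Sum>e\<in>E \<inter> {a<..}. c a e * t e)) / c a a"]) auto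
  qed
  then obtain t where t: "\<And>a. a \<in> E \<Longrightarrow> c a a * t a + (\<Sum>e\<in>E \<inter> {a<..}. c a e * t e) = y a"
    by blast
  show ?thesis
  proof (rule that)
    fix a assume a: "a \<in> E"
    have "(\<Sum>e\<in>E. c a e * t e) = (\<Sum>e\<in>insert a (E \<inter> {a<..}). c a e * t e)"
      using a tri by (intro sum.mono_neutral_right) (auto simp: not_less order.order_iff_strict neq_iff)
    also have "\<dots> = y a" using t[OF a] by simp
    finally show "(\<Sum>e\<in>E. c a e * t e) = y a" .
  qed
qed

section \<open>Orbits of matrices\<close>

lemma pattern_proj_in [simp]: "pattern_proj J M \<in> pattern_space J"
  by (simp add: pattern_proj_def pattern_space_def)

lemma pattern_proj_ident: "A \<in> pattern_space J \<Longrightarrow> pattern_proj J A = A"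
  by (auto simp: pattern_proj_def pattern_space_def vec_eq_iff)

lemma pattern_proj_add:
  "pattern_proj J (M + N) = pattern_proj J M + pattern_proj J (N :: ('a::monoid_add, 'n::finite) sqmat)"
  by (simp add: pattern_proj_def vec_eq_iff)

text \<open>
  Row operations downwards never move an entry outside of \<open>J\<close> into \<open>J\<close>:
  if \<open>(i, j) \<in> J\<close> and row \<open>k\<close> is added to row \<open>i\<close>, then
  \<open>(k, i) \<in> J\<close> and so \<open>(k, j) \<in> J\<close>. So truncation need only be
  applied once, which makes the truncated product a group action. The next lemma is the analogue
  for column operations.
\<close>

lemma pattern_proj_mult_left:
  fixes g M :: "('a::ring_1, 'n::{finite, linorder}) sqmat"
  assumes J: "J \<subseteq> pos_roots" "row_closed J" and g: "g \<in> pattern_group (J\<inverse>)"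
  shows "pattern_proj J (g ** pattern_proj J M) = pattern_proj J (g ** M)"
proof -
  have "(\<Sum>k\<in>UNIV. g $ i $ k * pattern_proj J M $ k $ j) = (\<Sum>k\<in>UNIV. g $ i $ k * M $ k $ j)"
    if ij: "(i, j) \<in> J" for i j
  proof (rule sum.cong)
    fix k
    have "g $ i $ k = 0" if n: "(k, j) \<notin> J"
    proof (rule ccontr)
      assume "g $ i $ k \<noteq> 0"
      hence "k = i \<or> (k, i) \<in> J" using pattern_groupD[OF g] by auto
      thus False using n ij transD[OF trans_row_closed[OF J]] J by blast
    qed
    thus "g $ i $ k * pattern_proj J M $ k $ j = g $ i $ k * M $ k $ j"
      by (auto simp: pattern_proj_def)
  qed simp
  thus ?thesis by (auto simp: pattern_proj_def matrix_matrix_mult_def vec_eq_iff)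
qed

lemma pattern_proj_mult_right:
  fixes h M :: "('a::ring_1, 'n::{finite, linorder}) sqmat"
  assumes J: "J \<subseteq> pos_roots" "row_closed J" and h: "h \<in> pattern_group (J\<inverse>)"
  shows "pattern_proj J (pattern_proj J M ** h) = pattern_proj J (M ** h)"
proof -
  have "(\<Sum>k\<in>UNIV. pattern_proj J M $ i $ k * h $ k $ j) = (\<Sum>k\<in>UNIV. M $ i $ k * h $ k $ j)"
    if ij: "(i, j) \<in> J" for i j
  proof (rule sum.cong)
    fix k
    have "h $ k $ j = 0" if n: "(i, k) \<notin> J"
    proof (rule ccontr)
      assume "h $ k $ j \<noteq> 0"
      hence "k = j \<or> (j, k) \<in> J" using pattern_groupD[OF h] by auto
      thus False using n ij transD[OF trans_row_closed[OF J]] J by blast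
    qed
    thus "pattern_proj J M $ i $ k * h $ k $ j = M $ i $ k * h $ k $ j"
      by (auto simp: pattern_proj_def)
  qed simp
  thus ?thesis by (auto simp: pattern_proj_def matrix_matrix_mult_def vec_eq_iff)
qed

definition left_orbit_mat :: "('n \<times> 'n) set \<Rightarrow> ('a::ring_1, 'n::finite) sqmat \<Rightarrow> ('a, 'n) sqmat set" where
  "left_orbit_mat J A = {pattern_proj J (g ** A) | g. g \<in> pattern_group (J\<inverse>)}"

definition right_orbit_mat :: "('n \<times> 'n) set \<Rightarrow> ('a::ring_1, 'n::finite) sqmat \<Rightarrow> ('a, 'n) sqmat set" where
  "right_orbit_mat J A = {pattern_proj J (A ** h) | h. h \<in> pattern_group (J\<inverse>)}"

lemma orbit_mat_subset: "left_orbit_mat J A \<subseteq> pattern_space J" "right_orbit_mat J A \<subseteq> pattern_space J"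
  by (auto simp: left_orbit_mat_def right_orbit_mat_def)

lemma trans_converse_roots:
  "J \<subseteq> pos_roots \<Longrightarrow> row_closed J \<Longrightarrow> trans (J\<inverse>)"
  using trans_row_closed by simp

lemma left_orbit_mat_trans:
  fixes A :: "('a::ring_1, 'n::{finite, linorder}) sqmat"
  assumes J: "J \<subseteq> pos_roots" "row_closed J"
    and "B \<in> left_orbit_mat J A" "C \<in> left_orbit_mat J B"
  shows "C \<in> left_orbit_mat J A"
proof -
  obtain g g' where g: "g \<in> pattern_group (J\<inverse>)" "g' \<in> pattern_group (J\<inverse>)"
    "B = pattern_proj J (g ** A)" "C = pattern_proj J (g' ** B)"
    using assms by (auto simp: left_orbit_mat_def)
  have "C = pattern_proj J ((g' ** g) ** A)"
    by (simp add: g pattern_proj_mult_left[OF J] matrix_mul_assoc)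
  thus ?thesis using pattern_group_mult[OF trans_converse_roots[OF J] g(2,1)]
    unfolding left_orbit_mat_def by blast
qed

lemma right_orbit_mat_trans:
  fixes A :: "('a::ring_1, 'n::{finite, linorder}) sqmat"
  assumes J: "J \<subseteq> pos_roots" "row_closed J"
    and "B \<in> right_orbit_mat J A" "C \<in> right_orbit_mat J B"
  shows "C \<in> right_orbit_mat J A"
proof -
  obtain g g' where g: "g \<in> pattern_group (J\<inverse>)" "g' \<in> pattern_group (J\<inverse>)"
    "B = pattern_proj J (A ** g)" "C = pattern_proj J (B ** g')"
    using assms by (auto simp: right_orbit_mat_def)
  have "C = pattern_proj J (A ** (g ** g'))"
    by (simp add: g pattern_proj_mult_right[OF J] matrix_mul_assoc)
  thus ?thesis using pattern_group_mult[OF trans_converse_roots[OF J] g(1,2)]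
    unfolding right_orbit_mat_def by blast
qed

lemma orbit_mat_sym:
  fixes A :: "('a::{field, finite}, 'n::{finite, linorder}) sqmat"
  assumes J: "J \<subseteq> pos_roots" "row_closed J" and A: "A \<in> pattern_space J"
  shows "B \<in> left_orbit_mat J A \<Longrightarrow> A \<in> left_orbit_mat J B"
    and "B \<in> right_orbit_mat J A \<Longrightarrow> A \<in> right_orbit_mat J B"
proof -
  assume "B \<in> left_orbit_mat J A"
  then obtain g where g: "g \<in> pattern_group (J\<inverse>)" "B = pattern_proj J (g ** A)"
    by (auto simp: left_orbit_mat_def)
  obtain g' where g': "g' \<in> pattern_group (J\<inverse>)" "g' ** g = mat 1"
    using lower_pattern_group_inverse[OF J(1) trans_row_closed[OF J] g(1)] by blast
  have "A = pattern_proj J (g' ** B)"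
    by (simp add: g(2) pattern_proj_mult_left[OF J g'(1)] matrix_mul_assoc g'(2) pattern_proj_ident[OF A])
  thus "A \<in> left_orbit_mat J B" using g'(1) unfolding left_orbit_mat_def by blast
next
  assume "B \<in> right_orbit_mat J A"
  then obtain g where g: "g \<in> pattern_group (J\<inverse>)" "B = pattern_proj J (A ** g)"
    by (auto simp: right_orbit_mat_def)
  obtain g' where g': "g' \<in> pattern_group (J\<inverse>)" "g ** g' = mat 1"
    using lower_pattern_group_inverse[OF J(1) trans_row_closed[OF J] g(1)] by blast
  have "pattern_proj J (B ** g') = pattern_proj J (A ** (g ** g'))"
    by (simp add: g(2) pattern_proj_mult_right[OF J g'(1)] matrix_mul_assoc)
  hence "A = pattern_proj J (B ** g')" by (simp add: g'(2) pattern_proj_ident[OF A])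
  thus "A \<in> right_orbit_mat J B" using g'(1) unfolding right_orbit_mat_def by blast
qed

lemma orbit_mat_refl:
  assumes "A \<in> pattern_space J"
  shows "A \<in> right_orbit_mat J A"
  unfolding right_orbit_mat_def using one_in_pattern_group[of "J\<inverse>"] pattern_proj_ident[OF assms]
  by (metis (mono_tags, lifting) matrix_mul_rid mem_Collect_eq)

text \<open>
  These translations, together with the injectivity of \<open>mat_char\<close> on the pattern space, reduce
  the theorem to truncated matrix products.
\<close>

lemma
  fixes J :: "('n::{finite, linorder} \<times> 'n) set" and A :: "('a::{field, finite}, 'n) sqmat"
  assumes J: "J \<subseteq> pos_roots" "trans J" and \<theta>: "nontrivial_add_char \<theta>" and A: "A \<in> pattern_space J"
  shows left_orbit_mat_char: "left_orbit \<theta> J (mat_char \<theta> J A) = mat_char \<theta> J ` left_orbit_mat J A" (is ?L)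
    and right_orbit_mat_char: "right_orbit \<theta> J (mat_char \<theta> J A) = mat_char \<theta> J ` right_orbit_mat J A" (is ?R)
    and bi_orbit_mat_char: "bi_orbit \<theta> J (mat_char \<theta> J A) =
      mat_char \<theta> J ` {pattern_proj J (g ** A ** h) | g h. g \<in> pattern_group (J\<inverse>) \<and> h \<in> pattern_group (J\<inverse>)}" (is ?B)
proof -
  have cm: "char_mat \<theta> J (mat_char \<theta> J A) = A"
    unfolding char_mat_def
    by (rule the_inv_into_f_f[OF bij_betw_imp_inj_on[OF bij_betw_mat_char[OF \<theta>]] A])
  have inv1: "transpose (matrix_inv (mat 1)) = (mat 1 :: ('a, 'n) sqmat)"
    using pattern_group_inverse(3)[OF J one_in_pattern_group, where ?'a = 'a] by (simp add: transpose_mat)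
  define \<tau> :: "('a, 'n) sqmat \<Rightarrow> ('a, 'n) sqmat" where "\<tau> u = transpose (matrix_inv u)" for u
  have G: "pattern_group (J\<inverse>) = \<tau> ` pattern_group J"
    using transpose_inverse_image[OF J, where ?'a = 'a] by (simp add: \<tau>_def)
  have one: "\<tau> (mat 1) = mat 1" unfolding \<tau>_def by (rule inv1)
  have act: "char_act \<theta> J u (mat_char \<theta> J A) v = mat_char \<theta> J (pattern_proj J (\<tau> u ** A ** \<tau> v))" for u v
    by (simp only: char_act_def cm \<tau>_def)
  show ?L
    by (simp only: left_orbit_def left_orbit_mat_def act one matrix_mul_rid G Setcompr_eq_image image_image)
  show ?R
    by (simp only: right_orbit_def right_orbit_mat_def act one matrix_mul_lid G Setcompr_eq_image image_image)
  show ?B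
    unfolding bi_orbit_def act G
  proof (intro equalityI subsetI)
    fix x assume "x \<in> {mat_char \<theta> J (pattern_proj J (\<tau> u ** A ** \<tau> v)) | u v. u \<in> pattern_group J \<and> v \<in> pattern_group J}"
    then obtain u v where "x = mat_char \<theta> J (pattern_proj J (\<tau> u ** A ** \<tau> v))" "u \<in> pattern_group J" "v \<in> pattern_group J"
      by blast
    thus "x \<in> mat_char \<theta> J ` {pattern_proj J (g ** A ** h) |g h. g \<in> \<tau> ` pattern_group J \<and> h \<in> \<tau> ` pattern_group J}"
      by blast
  next
    fix x assume "x \<in> mat_char \<theta> J ` {pattern_proj J (g ** A ** h) |g h. g \<in> \<tau> ` pattern_group J \<and> h \<in> \<tau> ` pattern_group J}"
    then obtain u v where "x = mat_char \<theta> J (pattern_proj J (\<tau> u ** A ** \<tau> v))" "u \<in> pattern_group J" "v \<in> pattern_group J"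
      by blast
    thus "x \<in> {mat_char \<theta> J (pattern_proj J (\<tau> u ** A ** \<tau> v)) | u v. u \<in> pattern_group J \<and> v \<in> pattern_group J}"
      by blast
  qed
qed

lemma biorbit_mat_Union:
  fixes A :: "('a::ring_1, 'n::{finite, linorder}) sqmat"
  assumes J: "J \<subseteq> pos_roots" "row_closed J"
  shows "{pattern_proj J (g ** A ** h) | g h. g \<in> pattern_group (J\<inverse>) \<and> h \<in> pattern_group (J\<inverse>)}
    = (\<Union>B\<in>left_orbit_mat J A. right_orbit_mat J B)" (is "?L = ?R")
proof (intro equalityI subsetI)
  fix C assume "C \<in> ?L"
  then obtain g h where gh: "g \<in> pattern_group (J\<inverse>)" "h \<in> pattern_group (J\<inverse>)" "C = pattern_proj J (g ** A ** h)"
    by blast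
  have "C = pattern_proj J (pattern_proj J (g ** A) ** h)"
    by (simp add: gh(3) pattern_proj_mult_right[OF J gh(2)])
  thus "C \<in> ?R" using gh(1,2) unfolding left_orbit_mat_def right_orbit_mat_def by blast
next
  fix C assume "C \<in> ?R"
  then obtain g h where gh: "g \<in> pattern_group (J\<inverse>)" "h \<in> pattern_group (J\<inverse>)"
      "C = pattern_proj J (pattern_proj J (g ** A) ** h)"
    unfolding left_orbit_mat_def right_orbit_mat_def by blast
  have "C = pattern_proj J (g ** A ** h)"
    by (simp add: gh(3) pattern_proj_mult_right[OF J gh(2)])
  thus "C \<in> ?L" using gh(1,2) by blast
qed

section \<open>Column bases\<close>

text \<open>
  A coefficient vector \<open>m\<close> for a combination of the rows of a matrix is a linear
  functional on its columns. The lemmas of this section express that the values of this functional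
  on a column basis can be prescribed and determine its values on all columns.
\<close>

lemma functional_vanishing_on_span:
  fixes S :: "('a::field ^ 'n::finite) set"
  assumes "x \<in> vec.span S" "\<And>y. y \<in> S \<Longrightarrow> (\<Sum>e\<in>UNIV. m e * y $ e) = 0"
  shows "(\<Sum>e\<in>UNIV. m e * x $ e) = 0"
  using assms(1)
proof (induction rule: vec.span_induct)
  case base
  show ?case
    by (auto simp: vec.subspace_def distrib_left sum.distrib mult.left_commute sum_distrib_left[symmetric])
next
  case step
  thus ?case using assms(2) by simp
qed

lemma column_basis_determines:
  assumes M: "column_basis M S" and 0: "\<And>s. s \<in> S \<Longrightarrow> (\<Sum>e\<in>UNIV. m e * M $ e $ s) = 0"
  shows "(\<Sum>e\<in>UNIV. m e * M $ e $ s) = 0"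
proof -
  have "column s M \<in> vec.span (columns M)"
    by (intro vec.span_base) (auto simp: columns_def)
  also have "\<dots> = vec.span ((\<lambda>s. column s M) ` S)" using M by (simp add: column_basis_def)
  finally have "(\<Sum>e\<in>UNIV. m e * column s M $ e) = 0"
    by (rule functional_vanishing_on_span) (use 0 in \<open>auto simp: column_def\<close>)
  thus ?thesis by (simp add: column_def)
qed

lemma column_basis_interpolate:
  fixes M :: "('a::field, 'n::finite) sqmat"
  assumes M: "column_basis M S"
  obtains m where "\<And>s. s \<in> S \<Longrightarrow> (\<Sum>e\<in>UNIV. m e * M $ e $ s) = y s"
proof -
  define f :: "'a ^ 'n \<Rightarrow> 'a ^ 'n"
    where "f c = (\<chi> i. y (the_inv_into S (\<lambda>s. column s M) c))" for c
  obtain g where g: "Vector_Spaces.linear (*s) (*s) g"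
      "\<forall>c\<in>(\<lambda>s. column s M) ` S. g c = f c"
    using M vec.linear_independent_extend[of "(\<lambda>s. column s M) ` S" f] by (auto simp: column_basis_def)
  show ?thesis
  proof (rule that)
    fix s assume s: "s \<in> S"
    have "the_inv_into S (\<lambda>s. column s M) (column s M) = s"
      using s M by (intro the_inv_into_f_f) (auto simp: column_basis_def)
    hence "matrix g *v column s M = (\<chi> i. y s)"
      using s g by (simp add: matrix_works f_def)
    hence "(matrix g *v column s M) $ undefined = y s" by simp
    thus "(\<Sum>e\<in>UNIV. matrix g $ undefined $ e * M $ e $ s) = y s"
      by (simp add: matrix_vector_mult_def column_def)
  qed
qed

section \<open>Main conditions\<close>

lemma main_conditionsD:
  "(i, j) \<in> main_conditions A \<Longrightarrow> A $ i $ j \<noteq> 0"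
  "(i, j) \<in> main_conditions A \<Longrightarrow> j < l \<Longrightarrow> A $ i $ l = 0"
  by (auto simp: main_conditions_def)

lemma main_conditions_unique:
  "(i, j) \<in> main_conditions A \<Longrightarrow> (i, k) \<in> main_conditions A \<Longrightarrow> j = k"
  by (metis linorder_neqE main_conditionsD)

lemma main_condition_right_of:
  assumes "A $ i $ s \<noteq> 0"
  obtains f where "(i, f) \<in> main_conditions A" "s \<le> f"
proof -
  define f where "f = Max {l. A $ i $ l \<noteq> 0}"
  have "f \<in> {l. A $ i $ l \<noteq> 0}" unfolding f_def using assms by (intro Max_in) auto
  moreover have le: "l \<le> f" if "A $ i $ l \<noteq> 0" for l
    unfolding f_def using that by (intro Max_ge) auto
  ultimately have "(i, f) \<in> main_conditions A" by (force simp: main_conditions_def)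
  thus ?thesis using le assms that by blast
qed

lemma main_conditions_subset:
  "A \<in> pattern_space J \<Longrightarrow> main_conditions A \<subseteq> J"
  by (auto simp: main_conditions_def pattern_space_def)

lemma is_templateD:
  assumes "is_template A" "(i, j) \<in> main_conditions A" "i < k" "k < j"
  shows "A $ k $ j = 0"
  using assms unfolding is_template_def by blast

text \<open>
  The lower of two main conditions in one column would contradict the zeros which the template
  property requires below the upper one.
\<close>

lemma template_main_column_inj:
  assumes "is_template A" "A \<in> pattern_space J" "J \<subseteq> pos_roots"
    "(i, f) \<in> main_conditions A" "(k, f) \<in> main_conditions A"
  shows "i = k"
proof -
  have "i < f" "k < f" using assms main_conditions_subset by (fastforce simp: pos_roots_def)+
  thus ?thesis using assms is_templateD main_conditionsD(1) by (metis linorder_neqE)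
qed

section \<open>Orbit directions of a template\<close>

text \<open>
  The orbits through \<open>A\<close> are the translates by \<open>A\<close> of these linear
  spaces, see \<open>orbits_inter\<close> below.
\<close>

definition left_directions ::
  "('n \<times> 'n) set \<Rightarrow> ('a::ring_1, 'n::finite) sqmat \<Rightarrow> ('a, 'n) sqmat set" where
  "left_directions J A = {pattern_proj J (M ** A) | M. M \<in> pattern_space (J\<inverse>)}"

definition right_directions ::
  "('n \<times> 'n) set \<Rightarrow> ('a::ring_1, 'n::finite) sqmat \<Rightarrow> ('a, 'n) sqmat set" where
  "right_directions J A = {pattern_proj J (A ** N) | N. N \<in> pattern_space (J\<inverse>)}"

text \<open>
  Column \<open>s\<close> of a right direction is a combination of the columns beyond
  \<open>s\<close>, available only if \<open>s\<close> is not normal. Its entry in row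
  \<open>a\<close> can be nonzero only if row \<open>a\<close> is nonzero beyond \<open>s\<close>,
  that is, if \<open>(a, s)\<close> lies on the arm of a main hook. Conversely, the columns of
  these main conditions, restricted to the rows above \<open>s\<close>, have their last nonzero
  entries in different rows, namely exactly in the rows in question, so every vector supported on
  these rows is a combination of them.
\<close>

lemma right_directions_template:
  fixes A X :: "('a::field, 'n::{finite, linorder}) sqmat"
  assumes J: "J \<subseteq> pos_roots" "row_closed J" and A: "A \<in> pattern_space J" "is_template A"
  shows "X \<in> right_directions J A \<longleftrightarrow>
    (\<forall>a s. X $ a $ s \<noteq> 0 \<longrightarrow> \<not> normal_column J s \<and> (\<exists>b. (a, b) \<in> main_conditions A \<and> a < s \<and> s < b))"
    (is "_ \<longleftrightarrow> ?arms")
proof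
  assume "X \<in> right_directions J A"
  then obtain N where N: "N \<in> pattern_space (J\<inverse>)" and X: "X = pattern_proj J (A ** N)"
    by (auto simp: right_directions_def)
  show ?arms
  proof (intro allI impI)
    fix a s assume as: "X $ a $ s \<noteq> 0"
    hence asJ: "(a, s) \<in> J" by (auto simp: X pattern_proj_def split: if_splits)
    have "(\<Sum>l\<in>UNIV. A $ a $ l * N $ l $ s) \<noteq> 0"
      using as asJ by (simp add: X pattern_proj_def matrix_matrix_mult_def)
    then obtain l where "A $ a $ l * N $ l $ s \<noteq> 0" by (meson sum.neutral)
    hence l: "A $ a $ l \<noteq> 0" "(s, l) \<in> J" using pattern_spaceD[OF N] by auto
    obtain b where b: "(a, b) \<in> main_conditions A" "l \<le> b" using l(1) by (rule main_condition_right_of)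
    have "a < s" "s < l" using J(1) asJ l(2) by (auto simp: pos_roots_def)
    thus "\<not> normal_column J s \<and> (\<exists>b. (a, b) \<in> main_conditions A \<and> a < s \<and> s < b)"
      using l b by (auto simp: normal_column_def)
  qed
next
  assume arms: ?arms
  define mc where "mc e = (SOME f. (e, f) \<in> main_conditions A)" for e
  have mc: "mc e = f" if "(e, f) \<in> main_conditions A" for e f
    unfolding mc_def using that main_conditions_unique by (metis someI_ex)
  \<comment> \<open>The rows whose main hook has column \<open>s\<close> on its arm; they index both the equations and the unknowns.\<close>
  define E where "E s = {e. e < s \<and> s < mc e \<and> (e, mc e) \<in> main_conditions A}" for s
  have "\<exists>t. \<forall>a. a \<in> E s \<longrightarrow> (\<Sum>e\<in>E s. A $ a $ mc e * t e) = X $ a $ s" for s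
  proof -
    have "A $ a $ mc a \<noteq> 0" if "a \<in> E s" for a using that main_conditionsD(1) by (auto simp: E_def)
    moreover have "A $ a $ mc e = 0" if "a \<in> E s" "e \<in> E s" "e < a" for a e
      using that by (intro is_templateD[OF A(2), of e]) (auto simp: E_def)
    ultimately obtain t where "\<And>a. a \<in> E s \<Longrightarrow> (\<Sum>e\<in>E s. A $ a $ mc e * t e) = X $ a $ s"
      using triangular_system_solvable[of "E s" "\<lambda>a e. A $ a $ mc e" "\<lambda>a. X $ a $ s"] by blast
    thus ?thesis by blast
  qed
  then obtain t where t: "\<And>s a. a \<in> E s \<Longrightarrow> (\<Sum>e\<in>E s. A $ a $ mc e * t s e) = X $ a $ s" by metis
  \<comment> \<open>The solutions are moved from the rows \<open>e\<close> to the main columns \<open>mc e\<close>.\<close>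
  define N :: "('a, 'n) sqmat"
    where "N = (\<chi> l s. if normal_column J s then 0 else (\<Sum>e\<in>E s. if l = mc e then t s e else 0))"
  have N: "N \<in> pattern_space (J\<inverse>)"
    unfolding pattern_space_def
  proof safe
    fix l s assume "N $ l $ s \<noteq> 0"
    hence s: "\<not> normal_column J s" and ne: "(\<Sum>e\<in>E s. if l = mc e then t s e else 0) \<noteq> 0"
      by (auto simp: N_def split: if_splits)
    obtain e where e: "e \<in> E s" "(if l = mc e then t s e else 0) \<noteq> 0"
      using ne by (rule sum.not_neutral_contains_not_neutral)
    have "l = mc e" by (rule ccontr) (use e in simp)
    hence "s < l" using e by (simp add: E_def)
    thus "(s, l) \<in> J" using s J(2) by (auto simp: normal_column_def row_closed_def)
  qed
  have "X $ a $ s = pattern_proj J (A ** N) $ a $ s" for a s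
  proof (cases "(a, s) \<in> J")
    case False
    hence "X $ a $ s = 0"
      using arms J(2) main_conditions_subset[OF A(1)] unfolding row_closed_def by blast
    thus ?thesis using False by (simp add: pattern_proj_def)
  next
    case True
    hence as: "a < s" using J(1) by (auto simp: pos_roots_def)
    have AN: "pattern_proj J (A ** N) $ a $ s = (\<Sum>l\<in>UNIV. A $ a $ l * N $ l $ s)"
      using True by (simp add: pattern_proj_def matrix_matrix_mult_def)
    show ?thesis
    proof (cases "normal_column J s")
      case True
      hence "X $ a $ s = 0" "N $ l $ s = 0" for l using arms by (blast, simp add: N_def)
      thus ?thesis unfolding AN by simp
    next
      case False
      have "(\<Sum>l\<in>UNIV. A $ a $ l * N $ l $ s)
          = (\<Sum>l\<in>UNIV. \<Sum>e\<in>E s. if l = mc e then A $ a $ l * t s e else 0)"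
      proof (rule sum.cong)
        fix l
        have "A $ a $ l * N $ l $ s = (\<Sum>e\<in>E s. A $ a $ l * (if l = mc e then t s e else 0))"
          using False by (simp add: N_def sum_distrib_left)
        also have "\<dots> = (\<Sum>e\<in>E s. if l = mc e then A $ a $ l * t s e else 0)"
          by (rule sum.cong) simp_all
        finally show "A $ a $ l * N $ l $ s = (\<Sum>e\<in>E s. if l = mc e then A $ a $ l * t s e else 0)" .
      qed simp
      also have "\<dots> = (\<Sum>e\<in>E s. \<Sum>l\<in>UNIV. if l = mc e then A $ a $ l * t s e else 0)"
        by (rule sum.swap)
      also have "\<dots> = (\<Sum>e\<in>E s. A $ a $ mc e * t s e)" by simp
      also have "\<dots> = X $ a $ s"
      proof (cases "a \<in> E s")
        case False
        have "A $ a $ mc e = 0" if "e \<in> E s" for e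
        proof (rule ccontr)
          assume "A $ a $ mc e \<noteq> 0"
          then obtain f where f: "(a, f) \<in> main_conditions A" "mc e \<le> f" by (rule main_condition_right_of)
          have "a \<in> E s" using mc[OF f(1)] f that as unfolding E_def by auto
          thus False using False by blast
        qed
        moreover have "X $ a $ s = 0"
        proof (rule ccontr)
          assume "X $ a $ s \<noteq> 0"
          then obtain b where b: "(a, b) \<in> main_conditions A" "s < b" using arms by blast
          have "a \<in> E s" using mc[OF b(1)] b as unfolding E_def by auto
          thus False using False by blast
        qed
        ultimately show ?thesis by simp
      qed (rule t)
      finally show ?thesis by (simp add: AN)
    qed
  qed
  hence "X = pattern_proj J (A ** N)" by (simp add: vec_eq_iff)
  thus "X \<in> right_directions J A" using N by (auto simp: right_directions_def)
qed

text \<open>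
  The possible rows \<open>a\<close> of common directions of the left and the right orbit, see
  \<open>directions_inter\<close> below.
\<close>

definition hook_row_space ::
  "('n \<times> 'n) set \<Rightarrow> ('a::field, 'n::{finite, linorder}) sqmat \<Rightarrow> 'n \<Rightarrow> ('a, 'n) vec set" where
  "hook_row_space J A a = {x. (\<exists>m. \<forall>s. x $ s = (if a < s then \<Sum>e\<in>rows_of A a. m e * A $ e $ s else 0))
     \<and> (\<forall>s. normal_column J s \<longrightarrow> x $ s = 0)}"

lemma rows_ofD:
  assumes "e \<in> rows_of A a"
  obtains b f where "(a, b) \<in> main_conditions A" "(e, f) \<in> main_conditions A" "e < a" "a < f" "f < b"
  using assms by (auto simp: rows_of_def)

lemma rows_of_main:
  assumes "(a, b) \<in> main_conditions A"
  shows "e \<in> rows_of A a \<longleftrightarrow> (\<exists>f. (e, f) \<in> main_conditions A \<and> e < a \<and> a < f \<and> f < b)"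
  using assms main_conditions_unique[OF assms] unfolding rows_of_def by blast

lemma rows_of_right_zero:
  assumes "e \<in> rows_of A a" "(a, b) \<in> main_conditions A" "b \<le> s"
  shows "A $ e $ s = 0"
proof -
  obtain f where "(e, f) \<in> main_conditions A" "f < b" using assms(1) rows_of_main[OF assms(2)] by blast
  thus ?thesis using assms(3) by (intro main_conditionsD(2)[of e f]) auto
qed

lemma rows_of_subset_J:
  assumes J: "row_closed J" and A: "A \<in> pattern_space J" and e: "e \<in> rows_of A a"
  shows "(e, a) \<in> J"
proof -
  obtain f where "(e, f) \<in> main_conditions A" "e < a" using e by (rule rows_ofD)
  thus ?thesis using J main_conditions_subset[OF A] unfolding row_closed_def by blast
qed

lemma hook_row_space_arm:
  assumes x: "x \<in> hook_row_space J A a" and s: "x $ s \<noteq> 0"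
  shows "\<not> normal_column J s" "\<exists>b. (a, b) \<in> main_conditions A \<and> a < s \<and> s < b"
    "s \<in> cols_hat A a"
proof -
  show "\<not> normal_column J s" using x s by (auto simp: hook_row_space_def)
  obtain m where "\<And>s. x $ s = (if a < s then \<Sum>e\<in>rows_of A a. m e * A $ e $ s else 0)"
    using x unfolding hook_row_space_def by blast
  hence as: "a < s" and ne: "(\<Sum>e\<in>rows_of A a. m e * A $ e $ s) \<noteq> 0" using s by presburger+
  obtain e where e: "e \<in> rows_of A a" and "m e * A $ e $ s \<noteq> 0"
    using ne by (rule sum.not_neutral_contains_not_neutral)
  hence es: "A $ e $ s \<noteq> 0" by simp
  obtain b where ab: "(a, b) \<in> main_conditions A" using e by (rule rows_ofD)
  have "s < b" using rows_of_right_zero[OF e ab] es by (meson not_less)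
  thus "\<exists>b. (a, b) \<in> main_conditions A \<and> a < s \<and> s < b" "s \<in> cols_hat A a"
    using ab as e es by (auto simp: cols_hat_def)
qed

text \<open>
  If a row \<open>i\<close> with main condition \<open>(i, f)\<close>, \<open>f \<ge> b\<close>,
  occurred in the combination, the one with the largest \<open>f\<close> would contribute a
  nonzero entry in column \<open>f\<close> that no other row could cancel, since main conditions
  lie in distinct columns. Rows with \<open>f \<le> a\<close> do not reach the columns beyond
  \<open>a\<close>. The rows that remain are those in \<open>rows_of A a\<close>.
\<close>

lemma row_sum_below_arm:
  fixes A :: "('a::field, 'n::{finite, linorder}) sqmat"
  assumes J: "J \<subseteq> pos_roots" and A: "A \<in> pattern_space J" "is_template A"
    and ab: "(a, b) \<in> main_conditions A"
    and m: "\<And>i. m i \<noteq> 0 \<Longrightarrow> i < a"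
    and vanish: "\<And>s. b \<le> s \<Longrightarrow> (\<Sum>i\<in>UNIV. m i * A $ i $ s) = 0"
    and s: "a < s"
  shows "(\<Sum>i\<in>UNIV. m i * A $ i $ s) = (\<Sum>i\<in>rows_of A a. m i * A $ i $ s)"
proof -
  define F where "F = {f. b \<le> f \<and> (\<exists>i. m i \<noteq> 0 \<and> (i, f) \<in> main_conditions A)}"
  have F: "F = {}"
  proof (rule ccontr)
    assume "F \<noteq> {}"
    hence "Max F \<in> F" by (intro Max_in) auto
    then obtain i where i: "b \<le> Max F" "m i \<noteq> 0" "(i, Max F) \<in> main_conditions A"
      by (auto simp: F_def)
    have "m k * A $ k $ Max F = 0" if "k \<noteq> i" for k
    proof (rule ccontr)
      assume k: "m k * A $ k $ Max F \<noteq> 0"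
      hence "A $ k $ Max F \<noteq> 0" by simp
      then obtain f where f: "(k, f) \<in> main_conditions A" "Max F \<le> f" by (rule main_condition_right_of)
      hence "f \<in> F" using k i(1) by (auto simp: F_def)
      hence "f = Max F" using f(2) by (simp add: antisym)
      thus False using f(1) i(3) that template_main_column_inj[OF A(2,1) J] by blast
    qed
    hence "(\<Sum>k\<in>UNIV. m k * A $ k $ Max F) = (\<Sum>k\<in>{i}. m k * A $ k $ Max F)"
      by (intro sum.mono_neutral_right) auto
    thus False using vanish[OF i(1)] i(2) main_conditionsD(1)[OF i(3)] by simp
  qed
  show ?thesis
  proof (rule sum.mono_neutral_right)
    show "\<forall>i\<in>UNIV - rows_of A a. m i * A $ i $ s = 0"
    proof (intro ballI; rule ccontr)
      fix i assume i: "i \<in> UNIV - rows_of A a" and ne: "m i * A $ i $ s \<noteq> 0"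
      hence "A $ i $ s \<noteq> 0" by simp
      then obtain f where f: "(i, f) \<in> main_conditions A" "s \<le> f" by (rule main_condition_right_of)
      have "f \<notin> F" using F by simp
      hence "f < b" using f ne by (auto simp: F_def)
      hence "i \<in> rows_of A a" using f s m[of i] ne rows_of_main[OF ab] by auto
      thus False using i by simp
    qed
  qed auto
qed

text \<open>
  The right-hand side has no condition connecting different rows: right directions form a
  coordinate space, and left directions are formed row by row. Within row \<open>a\<close>,
  membership in the right directions says that the row vanishes in normal columns and from the
  main condition on, and altogether if there is no main condition. Vanishing from the main
  condition on restricts the rows of \<open>A\<close> to be combined by
  \<open>row_sum_below_arm\<close>.
\<close>

lemma directions_inter:
  fixes A X :: "('a::field, 'n::{finite, linorder}) sqmat"
  assumes J: "J \<subseteq> pos_roots" "row_closed J" and A: "A \<in> pattern_space J" "is_template A"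
  shows "X \<in> left_directions J A \<inter> right_directions J A \<longleftrightarrow> (\<forall>a. X $ a \<in> hook_row_space J A a)"
proof (intro iffI allI)
  fix a assume X: "X \<in> left_directions J A \<inter> right_directions J A"
  hence arms: "\<And>a s. X $ a $ s \<noteq> 0 \<Longrightarrow>
      \<not> normal_column J s \<and> (\<exists>b. (a, b) \<in> main_conditions A \<and> a < s \<and> s < b)"
    using right_directions_template[OF J A, of X] by blast
  obtain M where M: "M \<in> pattern_space (J\<inverse>)" and XM: "X = pattern_proj J (M ** A)"
    using X by (auto simp: left_directions_def)
  have "\<exists>m. \<forall>s. X $ a $ s = (if a < s then \<Sum>e\<in>rows_of A a. m e * A $ e $ s else 0)"
  proof (cases "\<exists>b. (a, b) \<in> main_conditions A")
    case False
    hence "rows_of A a = {}" by (auto simp: rows_of_def)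
    thus ?thesis using arms[of a] False by auto
  next
    case True
    then obtain b where ab: "(a, b) \<in> main_conditions A" by blast
    have row: "X $ a $ s = (\<Sum>i\<in>UNIV. M $ a $ i * A $ i $ s)" if "a < s" for s
    proof -
      have "(a, s) \<in> J" using main_conditions_subset[OF A(1)] ab J(2) that
        unfolding row_closed_def by blast
      thus ?thesis by (simp add: XM pattern_proj_def matrix_matrix_mult_def)
    qed
    have "(\<Sum>i\<in>UNIV. M $ a $ i * A $ i $ s) = (\<Sum>i\<in>rows_of A a. M $ a $ i * A $ i $ s)" if "a < s" for s
    proof (rule row_sum_below_arm[OF J(1) A ab _ _ that])
      show "i < a" if "M $ a $ i \<noteq> 0" for i
        using pattern_spaceD[OF M that] J(1) by (auto simp: pos_roots_def)
      show "(\<Sum>i\<in>UNIV. M $ a $ i * A $ i $ s) = 0" if "b \<le> s" for s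
      proof -
        have "a < b" using main_conditions_subset[OF A(1)] ab J(1) by (auto simp: pos_roots_def)
        moreover have "X $ a $ s = 0"
          using arms[of a s] main_conditions_unique[OF ab] that by (metis not_less)
        ultimately show ?thesis using row[of s] that by simp
      qed
    qed
    moreover have "X $ a $ s = 0" if "\<not> a < s" for s using arms[of a s] that by blast
    ultimately show ?thesis using row by (intro exI[of _ "\<lambda>i. M $ a $ i"]) simp
  qed
  thus "X $ a \<in> hook_row_space J A a" using arms by (auto simp: hook_row_space_def)
next
  assume rows: "\<forall>a. X $ a \<in> hook_row_space J A a"
  have "X \<in> right_directions J A"
    using hook_row_space_arm(1,2)[OF rows[rule_format]] by (simp add: right_directions_template[OF J A])
  moreover have "X \<in> left_directions J A"
  proof -
    obtain m where m: "\<And>a s. X $ a $ s = (if a < s then \<Sum>e\<in>rows_of A a. m a e * A $ e $ s else 0)"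
      using rows unfolding hook_row_space_def mem_Collect_eq by metis
    define M :: "('a, 'n) sqmat" where "M = (\<chi> a e. if e \<in> rows_of A a then m a e else 0)"
    have "M \<in> pattern_space (J\<inverse>)"
      using rows_of_subset_J[OF J(2) A(1)] by (auto simp: M_def pattern_space_def)
    moreover have "X $ a $ s = pattern_proj J (M ** A) $ a $ s" for a s
    proof (cases "(a, s) \<in> J")
      case True
      hence "a < s" using J(1) by (auto simp: pos_roots_def)
      hence "X $ a $ s = (\<Sum>e\<in>rows_of A a. m a e * A $ e $ s)" using m by simp
      also have "\<dots> = (\<Sum>e\<in>UNIV. M $ a $ e * A $ e $ s)"
        by (intro sum.mono_neutral_cong_left) (auto simp: M_def)
      finally show ?thesis using True by (simp add: pattern_proj_def matrix_matrix_mult_def)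
    next
      case False
      have "X $ a $ s = 0"
      proof (rule ccontr)
        assume "X $ a $ s \<noteq> 0"
        hence "\<exists>b. (a, b) \<in> main_conditions A \<and> a < s \<and> s < b"
          using hook_row_space_arm(2) rows by blast
        thus False using False main_conditions_subset[OF A(1)] J(2) unfolding row_closed_def by blast
      qed
      thus ?thesis using False by (simp add: pattern_proj_def)
    qed
    hence "X = pattern_proj J (M ** A)" by (simp add: vec_eq_iff)
    ultimately show ?thesis by (auto simp: left_directions_def)
  qed
  ultimately show "X \<in> left_directions J A \<inter> right_directions J A" by blast
qed

section \<open>Coordinates on the common directions\<close>

lemma Gamma_pairing:
  fixes A :: "('a::field, 'n::{finite, linorder}) sqmat"
  shows "s \<in> cols_hat A a \<Longrightarrow>
      (\<Sum>e\<in>UNIV. m e * Gamma_hat A a $ e $ s) = (\<Sum>e\<in>rows_of A a. m e * A $ e $ s)"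
    and "s \<in> cols_normal J A a \<Longrightarrow>
      (\<Sum>e\<in>UNIV. m e * Gamma J A a $ e $ s) = (\<Sum>e\<in>rows_of A a. m e * A $ e $ s)"
  by (rule sum.mono_neutral_cong_right; simp add: Gamma_hat_def Gamma_def submat_def)+

lemma column_choiceD:
  assumes "column_choice J A Ci Ca" "(a, b) \<in> main_conditions A"
  shows "Ci a \<subseteq> cols_normal J A a" "column_basis (Gamma J A a) (cols_main J A a \<union> Ci a)"
    "Ca a \<subseteq> cols_hat A a - cols_normal J A a"
    "column_basis (Gamma_hat A a) (cols_main J A a \<union> Ci a \<union> Ca a)"
  using assms unfolding column_choice_def by blast+

lemma cols_subset:
  "cols_normal J A a \<subseteq> cols_hat A a" "cols_main J A a \<subseteq> cols_normal J A a"
  by (auto simp: cols_normal_def cols_main_def)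

lemma hook_row_space_minus:
  assumes "x \<in> hook_row_space J A a" "y \<in> hook_row_space J A a"
  shows "x - y \<in> hook_row_space J A a"
proof -
  obtain m n where
    "\<And>s. x $ s = (if a < s then \<Sum>e\<in>rows_of A a. m e * A $ e $ s else 0)"
    "\<And>s. y $ s = (if a < s then \<Sum>e\<in>rows_of A a. n e * A $ e $ s else 0)"
    using assms unfolding hook_row_space_def by blast
  hence "(x - y) $ s = (if a < s then \<Sum>e\<in>rows_of A a. (m e - n e) * A $ e $ s else 0)" for s
    by (simp add: left_diff_distrib sum_subtractf)
  hence "\<exists>m. \<forall>s. (x - y) $ s = (if a < s then \<Sum>e\<in>rows_of A a. m e * A $ e $ s else 0)"
    by (intro exI[of _ "\<lambda>e. m e - n e"] allI)
  thus ?thesis using assms by (simp add: hook_row_space_def)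
qed

text \<open>
  A member of the row space vanishes in the normal basis columns by definition, so if it also
  vanishes in the columns \<open>Ca a\<close>, then the functional vanishes on a basis of the
  column space of \<open>Gamma_hat\<close>.
\<close>

lemma hook_row_space_eq_0:
  assumes ch: "column_choice J A Ci Ca" and x: "x \<in> hook_row_space J A a"
    and 0: "\<And>s. (a, s) \<in> H_hat A Ca \<Longrightarrow> x $ s = 0"
  shows "x = 0"
proof (rule ccontr)
  assume "x \<noteq> 0"
  then obtain s where s: "x $ s \<noteq> 0" by (auto simp: vec_eq_iff)
  note arm = hook_row_space_arm[OF x s]
  then obtain b where ab: "(a, b) \<in> main_conditions A" by blast
  obtain m where m: "\<And>s. x $ s = (if a < s then \<Sum>e\<in>rows_of A a. m e * A $ e $ s else 0)"
    using x unfolding hook_row_space_def by blast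
  have pair: "(\<Sum>e\<in>UNIV. m e * Gamma_hat A a $ e $ k) = x $ k" if "k \<in> cols_hat A a" for k
    using that m[of k] by (simp add: Gamma_pairing) (auto simp: cols_hat_def)
  note D = column_choiceD[OF ch ab]
  have "(\<Sum>e\<in>UNIV. m e * Gamma_hat A a $ e $ k) = 0" if k: "k \<in> cols_main J A a \<union> Ci a \<union> Ca a" for k
  proof (cases "k \<in> Ca a")
    case True
    hence "x $ k = 0" using ab by (intro 0) (auto simp: H_hat_def)
    thus ?thesis using True D(3) pair by auto
  next
    case False
    hence "k \<in> cols_normal J A a" using k D(1) cols_subset(2) by blast
    hence "x $ k = 0" "k \<in> cols_hat A a" using x by (auto simp: cols_normal_def hook_row_space_def)
    thus ?thesis using pair by simp
  qed
  hence "(\<Sum>e\<in>UNIV. m e * Gamma_hat A a $ e $ s) = 0" by (rule column_basis_determines[OF D(4)])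
  thus False using pair[OF arm(3)] s by simp
qed

text \<open>
  The functional is prescribed as \<open>y\<close> on \<open>Ca a\<close> and as zero on the
  normal basis columns. The latter are a column basis of \<open>Gamma\<close>, so the combination
  vanishes in all normal columns.
\<close>

lemma hook_row_space_interpolate:
  assumes ch: "column_choice J A Ci Ca"
  shows "\<exists>x\<in>hook_row_space J A a. \<forall>s. (a, s) \<in> H_hat A Ca \<longrightarrow> x $ s = y s"
proof (cases "\<exists>b. (a, b) \<in> main_conditions A")
  case False
  have "0 \<in> hook_row_space J A a"
    unfolding hook_row_space_def by (auto intro!: exI[of _ "\<lambda>_. 0"])
  thus ?thesis using False by (auto simp: H_hat_def)
next
  case True
  then obtain b where ab: "(a, b) \<in> main_conditions A" by blast
  note D = column_choiceD[OF ch ab]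
  obtain m where m: "\<And>s. s \<in> cols_main J A a \<union> Ci a \<union> Ca a \<Longrightarrow>
      (\<Sum>e\<in>UNIV. m e * Gamma_hat A a $ e $ s) = (if s \<in> Ca a then y s else 0)"
    using column_basis_interpolate[OF D(4), of "\<lambda>s. if s \<in> Ca a then y s else 0"] by blast
  define x where "x = (\<chi> s. if a < s then \<Sum>e\<in>rows_of A a. m e * A $ e $ s else 0)"
  have "x $ s = 0" if n: "normal_column J s" for s
  proof (cases "s \<in> cols_hat A a")
    case True
    have "(\<Sum>e\<in>UNIV. m e * Gamma J A a $ e $ k) = 0" if k: "k \<in> cols_main J A a \<union> Ci a" for k
    proof -
      have kn: "k \<in> cols_normal J A a" using k D(1) cols_subset(2) by blast
      hence "k \<in> cols_hat A a" "k \<notin> Ca a" using D(3) cols_subset(1) by blast+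
      thus ?thesis using m[of k] k kn by (simp add: Gamma_pairing)
    qed
    hence "(\<Sum>e\<in>UNIV. m e * Gamma J A a $ e $ s) = 0" by (rule column_basis_determines[OF D(2)])
    moreover have "s \<in> cols_normal J A a" using True n by (simp add: cols_normal_def)
    ultimately show ?thesis by (simp add: x_def Gamma_pairing)
  next
    case False
    have "A $ e $ s = 0" if "a < s" "e \<in> rows_of A a" for e
    proof (cases "b \<le> s")
      case True
      thus ?thesis using rows_of_right_zero[OF that(2) ab] by blast
    next
      case nb: False
      hence "s < b" by simp
      thus ?thesis using False ab that unfolding cols_hat_def by blast
    qed
    thus ?thesis by (simp add: x_def)
  qed
  hence "x \<in> hook_row_space J A a" unfolding hook_row_space_def by (auto simp: x_def)
  moreover have "x $ s = y s" if "(a, s) \<in> H_hat A Ca" for s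
  proof -
    have s: "s \<in> Ca a" "s \<in> cols_hat A a" using that D(3) by (auto simp: H_hat_def)
    hence "a < s" by (auto simp: cols_hat_def)
    thus ?thesis using m[of s] s by (simp add: x_def Gamma_pairing)
  qed
  ultimately show ?thesis by blast
qed

lemma lower_action_entry:
  assumes J: "J \<subseteq> pos_roots" and g: "g \<in> pattern_group (J\<inverse>)" and "(a, s) \<in> J"
  shows "pattern_proj J (g ** X) $ a $ s = X $ a $ s + (\<Sum>k\<in>{..<a}. g $ a $ k * X $ k $ s)"
proof -
  obtain N where N: "g = mat 1 + N" "N \<in> pattern_space (J\<inverse>)" using g by (rule pattern_groupE)
  have low: "k < a" if "N $ a $ k \<noteq> 0" for k
    using pattern_spaceD[OF N(2) that] J by (auto simp: pos_roots_def)
  have "g ** X = X + N ** X" by (simp add: N matrix_add_rdistrib)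
  hence "pattern_proj J (g ** X) $ a $ s = X $ a $ s + (\<Sum>k\<in>UNIV. N $ a $ k * X $ k $ s)"
    using assms(3) by (simp add: pattern_proj_def) (simp add: matrix_matrix_mult_def)
  also have "(\<Sum>k\<in>UNIV. N $ a $ k * X $ k $ s) = (\<Sum>k\<in>{..<a}. g $ a $ k * X $ k $ s)"
    using low by (intro sum.mono_neutral_cong_right) (auto simp: N mat_def intro!: low)
  finally show ?thesis .
qed

lemma H_hat_subset:
  assumes "row_closed J" "A \<in> pattern_space J" "column_choice J A Ci Ca"
  shows "H_hat A Ca \<subseteq> J"
proof safe
  fix a s assume as: "(a, s) \<in> H_hat A Ca"
  then obtain b where ab: "(a, b) \<in> main_conditions A" and s: "s \<in> Ca a" by (auto simp: H_hat_def)
  have "a < s" using column_choiceD(3)[OF assms(3) ab] s by (auto simp: cols_hat_def)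
  thus "(a, s) \<in> J" using ab main_conditions_subset[OF assms(2)] assms(1) unfolding row_closed_def by blast
qed

text \<open>
  On \<open>H_hat\<close>, row \<open>a\<close> of \<open>g.X\<close> is row \<open>a\<close> of
  \<open>X\<close> plus a contribution of the rows before \<open>a\<close>. When these are known,
  the entries of row \<open>a\<close> of \<open>X\<close> on \<open>H_hat\<close> are prescribed,
  and these are coordinates on the row space.
\<close>

lemma unique_correction:
  fixes A :: "('a::field, 'n::{finite, linorder}) sqmat"
  assumes J: "J \<subseteq> pos_roots" "row_closed J" and A: "A \<in> pattern_space J" "is_template A"
    and ch: "column_choice J A Ci Ca" and g: "g \<in> pattern_group (J\<inverse>)"
  shows "\<exists>!X. X \<in> left_directions J A \<inter> right_directions J A \<and>
    (\<forall>(a, s)\<in>H_hat A Ca. pattern_proj J (g ** X) $ a $ s = Y $ a $ s)"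
proof -
  define sol where "sol X \<longleftrightarrow> (\<forall>a. X $ a \<in> hook_row_space J A a \<and>
    (\<forall>s. (a, s) \<in> H_hat A Ca \<longrightarrow> X $ a $ s + (\<Sum>k\<in>{..<a}. g $ a $ k * X $ k $ s) = Y $ a $ s))"
    for X :: "('a, 'n) sqmat"
  have sol_iff: "sol X \<longleftrightarrow> X \<in> left_directions J A \<inter> right_directions J A \<and>
    (\<forall>(a, s)\<in>H_hat A Ca. pattern_proj J (g ** X) $ a $ s = Y $ a $ s)" for X
  proof -
    have "pattern_proj J (g ** X) $ a $ s = X $ a $ s + (\<Sum>k\<in>{..<a}. g $ a $ k * X $ k $ s)"
      if "(a, s) \<in> H_hat A Ca" for a s
      using that H_hat_subset[OF J(2) A(1) ch] by (intro lower_action_entry[OF J(1) g]) blast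
    thus ?thesis unfolding sol_def directions_inter[OF J A] by auto
  qed
  have "\<exists>X. sol X"
  proof -
    define P where "P x a r \<longleftrightarrow> r \<in> hook_row_space J A a \<and>
      (\<forall>s. (a, s) \<in> H_hat A Ca \<longrightarrow> r $ s + (\<Sum>k\<in>{..<a}. g $ a $ k * x k $ s) = Y $ a $ s)"
      for x :: "'n \<Rightarrow> ('a, 'n) vec" and a r
    have "\<exists>x. \<forall>a. P x a (x a)"
    proof (rule dependent_wf_choice[OF wf_less_finite_linorder(1), where P = P])
      fix x x' :: "'n \<Rightarrow> ('a, 'n) vec" and a r
      assume "\<And>k. (k, a) \<in> {(x, y). x < y} \<Longrightarrow> x k = x' k"
      hence "(\<Sum>k\<in>{..<a}. g $ a $ k * x k $ s) = (\<Sum>k\<in>{..<a}. g $ a $ k * x' k $ s)" for s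
        by (intro sum.cong) auto
      thus "P x a r = P x' a r" by (simp add: P_def)
    next
      fix a and x :: "'n \<Rightarrow> ('a, 'n) vec"
      obtain r where "r \<in> hook_row_space J A a"
        "\<forall>s. (a, s) \<in> H_hat A Ca \<longrightarrow> r $ s = Y $ a $ s - (\<Sum>k\<in>{..<a}. g $ a $ k * x k $ s)"
        using hook_row_space_interpolate[OF ch, of a "\<lambda>s. Y $ a $ s - (\<Sum>k\<in>{..<a}. g $ a $ k * x k $ s)"]
        by blast
      hence "P x a r" by (simp add: P_def)
      thus "\<exists>r. P x a r" ..
    qed
    then obtain x where "\<And>a. P x a (x a)" by blast
    hence "sol (\<chi> a. x a)" by (simp add: sol_def P_def)
    thus ?thesis ..
  qed
  moreover have "X = X'" if X: "sol X" and X': "sol X'" for X X'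
  proof -
    have "X $ a = X' $ a" for a
    proof (induction a rule: wf_induct_rule[OF wf_less_finite_linorder(1)])
      case (1 a)
      hence IH: "(\<Sum>k\<in>{..<a}. g $ a $ k * X $ k $ s) = (\<Sum>k\<in>{..<a}. g $ a $ k * X' $ k $ s)" for s
        by (intro sum.cong) auto
      have "X $ a - X' $ a = 0"
      proof (rule hook_row_space_eq_0[OF ch])
        show "X $ a - X' $ a \<in> hook_row_space J A a"
          using X X' unfolding sol_def by (intro hook_row_space_minus) blast+
        fix s assume s: "(a, s) \<in> H_hat A Ca"
        have "X $ a $ s + (\<Sum>k\<in>{..<a}. g $ a $ k * X $ k $ s) =
            X' $ a $ s + (\<Sum>k\<in>{..<a}. g $ a $ k * X' $ k $ s)"
          using X X' s unfolding sol_def by simp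
        thus "(X $ a - X' $ a) $ s = 0" using IH[of s] by simp
      qed
      thus ?case by simp
    qed
    thus ?thesis by (simp add: vec_eq_iff)
  qed
  ultimately show ?thesis unfolding sol_iff[symmetric] by blast
qed

section \<open>Right orbits in a biorbit\<close>

lemma mat_add_one_in_pattern_group: "mat 1 + M \<in> pattern_group J \<longleftrightarrow> M \<in> pattern_space J"
  by (simp add: pattern_group_def)

lemma orbits_inter:
  assumes A: "A \<in> pattern_space J"
  shows "C \<in> left_orbit_mat J A \<inter> right_orbit_mat J A \<longleftrightarrow>
    (\<exists>X \<in> left_directions J A \<inter> right_directions J A. C = A + X)"
proof -
  have l: "pattern_proj J ((mat 1 + M) ** A) = A + pattern_proj J (M ** A)"
    and r: "pattern_proj J (A ** (mat 1 + M)) = A + pattern_proj J (A ** M)" for M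
    by (simp_all add: matrix_add_ldistrib matrix_add_rdistrib pattern_proj_add pattern_proj_ident[OF A])
  have L: "C \<in> left_orbit_mat J A \<longleftrightarrow> C - A \<in> left_directions J A"
  proof
    assume "C \<in> left_orbit_mat J A"
    then obtain g where g: "g \<in> pattern_group (J\<inverse>)" "C = pattern_proj J (g ** A)"
      by (auto simp: left_orbit_mat_def)
    thus "C - A \<in> left_directions J A"
      by (elim pattern_groupE) (auto simp: l left_directions_def)
  next
    assume "C - A \<in> left_directions J A"
    then obtain M where M: "M \<in> pattern_space (J\<inverse>)" "C - A = pattern_proj J (M ** A)"
      by (auto simp: left_directions_def)
    hence "C = pattern_proj J ((mat 1 + M) ** A)" unfolding l by (simp add: algebra_simps)
    thus "C \<in> left_orbit_mat J A" using M(1) mat_add_one_in_pattern_group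
      unfolding left_orbit_mat_def by blast
  qed
  have R: "C \<in> right_orbit_mat J A \<longleftrightarrow> C - A \<in> right_directions J A"
  proof
    assume "C \<in> right_orbit_mat J A"
    then obtain h where h: "h \<in> pattern_group (J\<inverse>)" "C = pattern_proj J (A ** h)"
      by (auto simp: right_orbit_mat_def)
    thus "C - A \<in> right_directions J A"
      by (elim pattern_groupE) (auto simp: r right_directions_def)
  next
    assume "C - A \<in> right_directions J A"
    then obtain M where M: "M \<in> pattern_space (J\<inverse>)" "C - A = pattern_proj J (A ** M)"
      by (auto simp: right_directions_def)
    hence "C = pattern_proj J (A ** (mat 1 + M))" unfolding r by (simp add: algebra_simps)
    thus "C \<in> right_orbit_mat J A" using M(1) mat_add_one_in_pattern_group
      unfolding right_orbit_mat_def by blast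
  qed
  have "C = A + X \<longleftrightarrow> C - A = X" for X by (auto simp: algebra_simps)
  thus ?thesis using L R by auto
qed

text \<open>
  The set \<open>{B. B \<in> left_orbit_mat J A \<and> B \<in> right_orbit_mat J B0}\<close> is
  the translate by \<open>g\<close> of the intersection of the two orbits of \<open>A\<close>,
  where \<open>B0 = g.A\<close>, hence it is \<open>B0 + g.W\<close> for the space
  \<open>W\<close> of common directions. Requiring zeros on \<open>H_hat\<close> prescribes
  \<open>g.X\<close> as \<open>- B0\<close> there.
\<close>

lemma unique_representative:
  fixes A :: "('a::{field, finite}, 'n::{finite, linorder}) sqmat"
  assumes J: "J \<subseteq> pos_roots" "row_closed J" and A: "A \<in> pattern_space J" "is_template A"
    and ch: "column_choice J A Ci Ca" and B0: "B0 \<in> left_orbit_mat J A"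
  shows "\<exists>!B. B \<in> left_orbit_mat J A \<and> B \<in> right_orbit_mat J B0 \<and> (\<forall>(a, s)\<in>H_hat A Ca. B $ a $ s = 0)"
proof -
  obtain g where g: "g \<in> pattern_group (J\<inverse>)" and B0g: "B0 = pattern_proj J (g ** A)"
    using B0 by (auto simp: left_orbit_mat_def)
  obtain g' where g': "g' \<in> pattern_group (J\<inverse>)" "g' ** g = mat 1"
    using lower_pattern_group_inverse[OF J(1) trans_row_closed[OF J] g] by blast
  let ?W = "left_directions J A \<inter> right_directions J A"
  have commute: "pattern_proj J (B0 ** h) = pattern_proj J (g ** pattern_proj J (A ** h))"
    if "h \<in> pattern_group (J\<inverse>)" for h
    by (simp add: B0g pattern_proj_mult_left[OF J g] pattern_proj_mult_right[OF J that] matrix_mul_assoc)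
  have coset: "B \<in> left_orbit_mat J A \<and> B \<in> right_orbit_mat J B0 \<longleftrightarrow> (\<exists>X\<in>?W. B = B0 + pattern_proj J (g ** X))" for B
  proof
    assume B: "B \<in> left_orbit_mat J A \<and> B \<in> right_orbit_mat J B0"
    then obtain h where h: "h \<in> pattern_group (J\<inverse>)" "B = pattern_proj J (B0 ** h)"
      by (auto simp: right_orbit_mat_def)
    define C where "C = pattern_proj J (A ** h)"
    have BC: "B = pattern_proj J (g ** C)" by (simp add: C_def h(2) commute[OF h(1)])
    have "C \<in> pattern_space J" by (simp add: C_def)
    moreover have "B \<in> left_orbit_mat J C" using BC g unfolding left_orbit_mat_def by blast
    ultimately have "C \<in> left_orbit_mat J B" by (rule orbit_mat_sym(1)[OF J])
    hence "C \<in> left_orbit_mat J A" by (rule left_orbit_mat_trans[OF J conjunct1[OF B]])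
    moreover have "C \<in> right_orbit_mat J A"
      using h(1) C_def unfolding right_orbit_mat_def by blast
    ultimately obtain X where X: "X \<in> ?W" "C = A + X" using orbits_inter[OF A(1)] by blast
    have "B = B0 + pattern_proj J (g ** X)"
      by (simp add: BC X(2) B0g matrix_add_ldistrib pattern_proj_add)
    thus "\<exists>X\<in>?W. B = B0 + pattern_proj J (g ** X)" using X(1) by blast
  next
    assume "\<exists>X\<in>?W. B = B0 + pattern_proj J (g ** X)"
    then obtain X where X: "X \<in> ?W" "B = B0 + pattern_proj J (g ** X)" by blast
    define C where "C = A + X"
    have C: "C \<in> left_orbit_mat J A" "C \<in> right_orbit_mat J A"
      using orbits_inter[OF A(1), of C] X(1) C_def by blast+
    have BC: "B = pattern_proj J (g ** C)"
      by (simp add: C_def X(2) B0g matrix_add_ldistrib pattern_proj_add)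
    obtain h where h: "h \<in> pattern_group (J\<inverse>)" "C = pattern_proj J (A ** h)"
      using C(2) by (auto simp: right_orbit_mat_def)
    have "B \<in> left_orbit_mat J C" using BC g unfolding left_orbit_mat_def by blast
    hence "B \<in> left_orbit_mat J A" by (rule left_orbit_mat_trans[OF J C(1)])
    moreover have "B = pattern_proj J (B0 ** h)" using commute[OF h(1)] BC h(2) by simp
    hence "B \<in> right_orbit_mat J B0" using h(1) unfolding right_orbit_mat_def by blast
    ultimately show "B \<in> left_orbit_mat J A \<and> B \<in> right_orbit_mat J B0" by blast
  qed
  have H: "(\<forall>(a, s)\<in>H_hat A Ca. (B0 + pattern_proj J (g ** X)) $ a $ s = 0) \<longleftrightarrow>
      (\<forall>(a, s)\<in>H_hat A Ca. pattern_proj J (g ** X) $ a $ s = (- B0) $ a $ s)" for X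
    by (auto simp: add_eq_0_iff)
  obtain X where X: "X \<in> ?W" "\<forall>(a, s)\<in>H_hat A Ca. pattern_proj J (g ** X) $ a $ s = (- B0) $ a $ s"
    and uniq: "\<And>X'. X' \<in> ?W \<Longrightarrow> (\<forall>(a, s)\<in>H_hat A Ca. pattern_proj J (g ** X') $ a $ s = (- B0) $ a $ s) \<Longrightarrow> X' = X"
    using unique_correction[OF J A ch g, of "- B0"] by (elim ex1E) blast
  show ?thesis
  proof (rule ex1I[of _ "B0 + pattern_proj J (g ** X)"])
    show "B0 + pattern_proj J (g ** X) \<in> left_orbit_mat J A \<and> B0 + pattern_proj J (g ** X) \<in> right_orbit_mat J B0 \<and>
      (\<forall>(a, s)\<in>H_hat A Ca. (B0 + pattern_proj J (g ** X)) $ a $ s = 0)"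
      using coset X H by blast
  next
    fix B assume B: "B \<in> left_orbit_mat J A \<and> B \<in> right_orbit_mat J B0 \<and> (\<forall>(a, s)\<in>H_hat A Ca. B $ a $ s = 0)"
    then obtain X' where X': "X' \<in> ?W" "B = B0 + pattern_proj J (g ** X')" using coset by blast
    have "X' = X" using B X' H uniq by blast
    thus "B = B0 + pattern_proj J (g ** X)" using X'(2) by simp
  qed
qed

theorem theorem8p18:
  fixes J :: "('n::{finite, linorder} \<times> 'n) set"
    and \<theta> :: "'a::{field, finite} \<Rightarrow> complex"
    and A :: "('a, 'n) sqmat"
    and Ci Ca :: "'n \<Rightarrow> 'n set"
  assumes "J \<subseteq> pos_roots"
    and "row_closed J"
    and "nontrivial_add_char \<theta>"
    and "A \<in> pattern_space J"
    and "is_normal_template J A"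
    and "column_choice J A Ci Ca"
  shows "{right_orbit \<theta> J \<psi> | \<psi>. \<psi> \<in> I_set \<theta> J A Ca}
           = {X. (\<exists>\<phi>\<in>linear_chars J. X = right_orbit \<theta> J \<phi>)
                 \<and> X \<subseteq> bi_orbit \<theta> J (mat_char \<theta> J A)}
         \<and> (\<forall>\<psi>\<in>I_set \<theta> J A Ca. \<forall>\<phi>\<in>I_set \<theta> J A Ca. \<psi> \<noteq> \<phi> \<longrightarrow>
              right_orbit \<theta> J \<psi> \<inter> right_orbit \<theta> J \<phi> = {})"
proof -
  note J = assms(1,2) and \<theta> = assms(3) and A = assms(4) and ch = assms(6)
  have tmpl: "is_template A" using assms(5) by (simp add: is_normal_template_def)
  let ?c = "mat_char \<theta> J"
  note tr = trans_row_closed[OF J]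
  have bij: "bij_betw ?c (pattern_space J) (linear_chars J)" by (rule bij_betw_mat_char[OF \<theta>])
  hence inj: "inj_on ?c (pattern_space J)" by (simp add: bij_betw_def)
  have Lo: "left_orbit \<theta> J (?c A) = ?c ` left_orbit_mat J A"
    by (rule left_orbit_mat_char[OF J(1) tr \<theta> A])
  have Ro: "right_orbit \<theta> J (?c B) = ?c ` right_orbit_mat J B" if "B \<in> pattern_space J" for B
    by (rule right_orbit_mat_char[OF J(1) tr \<theta> that])
  have Bo: "bi_orbit \<theta> J (?c A) = ?c ` (\<Union>B\<in>left_orbit_mat J A. right_orbit_mat J B)"
    using bi_orbit_mat_char[OF J(1) tr \<theta> A] biorbit_mat_Union[OF J, of A] by simp
  define S where "S = {B \<in> left_orbit_mat J A. \<forall>(a, s)\<in>H_hat A Ca. B $ a $ s = 0}"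
  have SV: "S \<subseteq> pattern_space J" using orbit_mat_subset(1) by (auto simp: S_def)
  have I: "I_set \<theta> J A Ca = ?c ` S"
  proof -
    have "?c B \<in> ?c ` left_orbit_mat J A \<longleftrightarrow> B \<in> left_orbit_mat J A" if "B \<in> pattern_space J" for B
      using inj_on_image_mem_iff[OF inj that orbit_mat_subset(1)] .
    thus ?thesis unfolding I_set_def Lo using SV S_def by blast
  qed
  have rep: "\<exists>!B. B \<in> S \<and> B \<in> right_orbit_mat J B0" if "B0 \<in> left_orbit_mat J A" for B0
    using unique_representative[OF J A tmpl ch that] by (simp add: S_def conj_ac)
  have eq_orbit: "right_orbit_mat J B = right_orbit_mat J C"
    if BC: "B \<in> right_orbit_mat J C" "C \<in> pattern_space J" for B C :: "('a, 'n) sqmat"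
    using right_orbit_mat_trans[OF J BC(1)] right_orbit_mat_trans[OF J orbit_mat_sym(2)[OF J BC(2,1)]]
    by blast
  have orbits: "{right_orbit \<theta> J \<psi> | \<psi>. \<psi> \<in> I_set \<theta> J A Ca}
      = {X. (\<exists>\<phi>\<in>linear_chars J. X = right_orbit \<theta> J \<phi>) \<and> X \<subseteq> bi_orbit \<theta> J (?c A)}"
  proof (intro equalityI subsetI)
    fix X assume "X \<in> {right_orbit \<theta> J \<psi> | \<psi>. \<psi> \<in> I_set \<theta> J A Ca}"
    then obtain B where B: "B \<in> S" "X = right_orbit \<theta> J (?c B)" by (auto simp: I)
    have "?c B \<in> linear_chars J" using B(1) SV bij by (auto simp: bij_betw_def)
    moreover have "X \<subseteq> bi_orbit \<theta> J (?c A)"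
      using B SV Ro[of B] unfolding Bo by (auto simp: S_def)
    ultimately show "X \<in> {X. (\<exists>\<phi>\<in>linear_chars J. X = right_orbit \<theta> J \<phi>) \<and> X \<subseteq> bi_orbit \<theta> J (?c A)}"
      using B(2) by blast
  next
    fix X assume X: "X \<in> {X. (\<exists>\<phi>\<in>linear_chars J. X = right_orbit \<theta> J \<phi>) \<and> X \<subseteq> bi_orbit \<theta> J (?c A)}"
    then obtain \<phi> where \<phi>: "\<phi> \<in> linear_chars J" "X = right_orbit \<theta> J \<phi>" by blast
    then obtain C where C: "C \<in> pattern_space J" "\<phi> = ?c C"
      using bij unfolding bij_betw_def by blast
    hence C: "C \<in> pattern_space J" "X = ?c ` right_orbit_mat J C" using Ro \<phi>(2) by simp_all
    have "?c C \<in> ?c ` (\<Union>B\<in>left_orbit_mat J A. right_orbit_mat J B)"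
      using X C(2) orbit_mat_refl[OF C(1)] unfolding Bo by blast
    moreover have "(\<Union>B\<in>left_orbit_mat J A. right_orbit_mat J B) \<subseteq> pattern_space J"
      by (rule UN_least) (rule orbit_mat_subset(2))
    ultimately have "C \<in> (\<Union>B\<in>left_orbit_mat J A. right_orbit_mat J B)"
      using inj_on_image_mem_iff[OF inj C(1)] by simp
    then obtain B0 where B0: "B0 \<in> left_orbit_mat J A" "C \<in> right_orbit_mat J B0" by blast
    obtain B where B: "B \<in> S" "B \<in> right_orbit_mat J B0" using rep[OF B0(1)] by blast
    have "B0 \<in> pattern_space J" using B0(1) orbit_mat_subset(1) by blast
    hence "right_orbit_mat J C = right_orbit_mat J B" using eq_orbit[OF B0(2)] eq_orbit[OF B(2)] by simp
    moreover have "B \<in> pattern_space J" using B(1) SV by blast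
    ultimately have "X = right_orbit \<theta> J (?c B)" using C(2) Ro by simp
    thus "X \<in> {right_orbit \<theta> J \<psi> | \<psi>. \<psi> \<in> I_set \<theta> J A Ca}" using B(1) I by blast
  qed
  have disjoint: "right_orbit \<theta> J \<psi> \<inter> right_orbit \<theta> J \<phi> = {}"
    if I': "\<psi> \<in> I_set \<theta> J A Ca" "\<phi> \<in> I_set \<theta> J A Ca" and ne: "\<psi> \<noteq> \<phi>" for \<psi> \<phi>
  proof -
    obtain B C where BC: "B \<in> S" "C \<in> S" "\<psi> = ?c B" "\<phi> = ?c C" using I' I by blast
    have V: "B \<in> pattern_space J" "C \<in> pattern_space J" using BC SV by auto
    show "right_orbit \<theta> J \<psi> \<inter> right_orbit \<theta> J \<phi> = {}"
    proof (rule ccontr)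
      assume "right_orbit \<theta> J \<psi> \<inter> right_orbit \<theta> J \<phi> \<noteq> {}"
      hence "?c ` (right_orbit_mat J B \<inter> right_orbit_mat J C) \<noteq> {}"
        using inj_on_image_Int[OF inj orbit_mat_subset(2) orbit_mat_subset(2)] by (simp add: BC Ro V)
      then obtain D where D: "D \<in> right_orbit_mat J B" "D \<in> right_orbit_mat J C" by blast
      hence "right_orbit_mat J B = right_orbit_mat J C"
        using eq_orbit[OF D(1) V(1)] eq_orbit[OF D(2) V(2)] by simp
      hence "C \<in> right_orbit_mat J B" using orbit_mat_refl[OF V(2)] by simp
      moreover have "B \<in> right_orbit_mat J B" by (rule orbit_mat_refl[OF V(1)])
      moreover have "B \<in> left_orbit_mat J A" using BC(1) by (simp add: S_def)
      ultimately have "B = C" using rep BC(1,2) by blast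
      thus False using ne BC by simp
    qed
  qed
  show ?thesis by (intro conjI ballI impI) (rule orbits | erule (2) disjoint)+
qed

end
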